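(* Suppose that the discretization assumption (A) on the spaces $V_n$ stated in the context holds, let $\gamma$ be a power spectral density with associated $\nu\in\mathbb{N}$, and let $\lambda_{\max}=\lambda_n^{(n)}$. (1) There exists $N_{\mathrm{Cheb}}\in\mathbb{N}$ such that for any $n>N_{\mathrm{Cheb}}$, the root-mean-squared error between the discretized field $\mathcal{Z}_n$ and its polynomial approximation $\widehat{\mathcal{Z}}_{n,K}$ of order $K>\nu$ is bounded by $$\Vert\mathcal{Z}_n-\widehat{\mathcal{Z}}_{n,K}\Vert_{L^2(\Omega;H)}\le2(C_\lambda)^\nu(\pi\nu)^{-1}\,\mathrm{TV}(\gamma^{(\nu)})\,n^{\alpha\nu+1/2}(K-\nu)^{-\nu},$$ where $\mathrm{TV}(\gamma^{(\nu)})$ denotes the total variation over $[0,\lambda_{\max}]$ of the $\nu$-th derivative of $\gamma$. (2) If there exists $\chi>0$ such that the map $z\in\mathbb{C}\mapsto\gamma(z)$ is holomorphic inside the ellipse $E_\chi\subset\mathbb{C}$ centered at $z=\lambda_{\max}/2$, with foci $z_1=0$ and $z_2=\lambda_{\max}$ and semi-major axis $a_\chi=\lambda_{\max}/2+\chi$ (for each $n$ considered, with $\chi$ not depending on $n$), then there exists $M_{\mathrm{Cheb}}\in\mathbb{N}$ such that for any $n>M_{\mathrm{Cheb}}$ and any $K\in\mathbb{N}$, $$\Vert\mathcal{Z}_n-\widehat{\mathcal{Z}}_{n,K}\Vert_{L^2(\Omega;H)}\le(2C_\lambda\chi^{-1})^{1/2}\Big(\sup_{z\in E_\chi}|\ga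mma(z)|\Big)n^{(\alpha+1)/2}\exp\big(-(2C_\lambda\chi^{-1})^{-1/2}\,n^{-\alpha/2}K\big).$$
   Context: Setting. $(\mathcal{M},g)$ is a compact connected oriented Riemannian manifold of dimension $d\ge1$, with smooth boundary or without boundary. $H=L^2(\mathcal{M},g)$ is the real $L^2$ space for the Riemannian volume measure, with inner product $(\cdot,\cdot)_0$ and norm $\Vert\cdot\Vert_0$. $-\Delta_{\mathcal{M}}$ is the (nonnegative) Laplace--Beltrami operator, with Dirichlet or homogeneous Neumann boundary conditions if $\partial\mathcal{M}\ne\emptyset$. $(\lambda_k,e_k)_{k\in\mathbb{N}}$, $\mathbb{N}=\{1,2,\dots\}$, are its eigenpairs, with $0\le\lambda_1\le\lambda_2\le\cdots$ (counted with multiplicity) and $(e_k)$ an orthonormal basis of $H$. $M_0\in\{0,1\}$ is the multiplicity of the eigenvalue $0$. $\alpha=2/d$, and $c_\lambda,C_\lambda>0$ are constants given by Weyl's law such that $c_\lambda j^\alpha\le\lambda_j\le C_\lambda j^\alpha$ for all $j$ with $\lambda_j>0$. Power spectral density. A function $\gamma:[0,\infty)\to\mathbb{R}$ such that: (i) for some $\nu\in\mathbb{N}$, $\gamma$ is $\nu$ times differentiable with continuous derivatives up to order $\nu-1$ and a $\nu$-th derivative of bounded variation; (ii) $\gamma(\lambda)\to0$ as $\lambda\to\infty$; (iii) there are $L_\gamma,C_\gamma',\beta>0$ with $|\gamma'(\lambda)|\le C'_\gamma|\lambda|^{-(1+\beta)}$ for all $\lambda\ge L_\gamma$. All power spectral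 densities considered satisfy $2\alpha\beta-1>0$. When $\gamma$ is evaluated at complex arguments, a holomorphic extension of $\gamma$, still denoted $\gamma$, is meant. Galerkin discretization. $\dot H^1$ is the completion of the span of the $e_k$ under the norm $\Vert f\Vert_1^2=\sum_{k\le M_0}|(f,e_k)_0|^2+\sum_{k>M_0}\lambda_k|(f,e_k)_0|^2$. For each $n$, $V_n\subset\dot H^1$ is an $n$-dimensional subspace containing the constant functions. $-\Delta_n:V_n\to V_n$ is defined by $(-\Delta_n\varphi,v)_0=(\nabla_{\mathcal{M}}\varphi,\nabla_{\mathcal{M}}v)_0$ for all $\varphi,v\in V_n$. Its eigenvalues are $0\le\lambda_1^{(n)}\le\cdots\le\lambda_n^{(n)}$, with an orthonormal basis of eigenfunctions $e_1^{(n)},\dots,e_n^{(n)}$ of $V_n$ (for $\Vert\cdot\Vert_0$). Assumption (A). There exist constants $N_0,C_1,C_2>0$, $l_\lambda\in(0,1]$ and exponents $r,s>0$, $q\ge1$ with $\alpha q\le\min\{2s,r+\alpha\}$ such that for all $n\ge N_0$ and all $k\in\{M_0+1,\dots,n\}$: $|\lambda_k^{(n)}-\lambda_k|\le C_1\lambda_k^qn^{-r}$, $\Vert e_k^{(n)}-e_k\Vert_0^2\le C_2\lambda_k^qn^{-2s}$, and $\lambda_k^{(n)}\ge l_\lambda\lambda_k$. Fields. $W_1,\dots,W_n$ are independent standard Gaussian variables on a complete probability space $(\Omega,\mathcal{A},\mathbb{P})$; $\mathcal{Z}_n=\sum_{k=1}^nW_k\gamma(\lambda_k^{(n)})e_k^{(n)}$.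 Let $T_k$ be the Chebyshev polynomials of the first kind, $\tilde\gamma(t)=\gamma(\lambda_{\max}(1+t)/2)$ for $t\in[-1,1]$, $c_k=\frac2\pi\int_{-1}^1\tilde\gamma(t)T_k(t)\frac{dt}{\sqrt{1-t^2}}$, $\mathcal{S}_K[\tilde\gamma]=\frac12c_0T_0+\sum_{k=1}^Kc_kT_k$, and $P_{\gamma,K}(\lambda)=\mathcal{S}_K[\tilde\gamma](2\lambda/\lambda_{\max}-1)$ for $\lambda\in[0,\lambda_{\max}]$. Then $\widehat{\mathcal{Z}}_{n,K}=\sum_{k=1}^nW_kP_{\gamma,K}(\lambda_k^{(n)})e_k^{(n)}$, with the same weights as $\mathcal{Z}_n$. $\Vert X\Vert_{L^2(\Omega;H)}=(\mathbb{E}\Vert X\Vert_0^2)^{1/2}$.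
   Formalization: Part (2) is false as stated when αq = r+α and C_λ is small; there the formal version also assumes C_λ is large enough: some C>0 with λ_j ≤ C j^α (whenever λ_j>0) satisfies C + C_1 C^q ≤ 2C_λ. If αq < r+α nothing is added. *)

theory Defs
  imports "HOL-Complex_Analysis.Complex_Analysis" "HOL-Probability.Probability"
begin

section \<open>Smooth functions on subsets of Euclidean space\<close>

text \<open>For open \<open>S\<close>, \<open>smooth_open S f\<close> says that all iterated partial derivatives of \<open>f\<close> exist
  and are continuous on \<open>S\<close>; \<open>D [i, j, \<dots>]\<close> is the iterated partial derivative
  \<open>\<partial>\<^sub>i \<partial>\<^sub>j \<dots> f\<close>.\<close>

definition smooth_open :: "(real^'d::finite) set \<Rightarrow> (real^'d \<Rightarrow> real) \<Rightarrow> bool" where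
  "smooth_open S f \<longleftrightarrow>
    (\<exists>D :: 'd list \<Rightarrow> real^'d \<Rightarrow> real.
       (\<forall>x\<in>S. D [] x = f x) \<and>
       (\<forall>js. continuous_on S (D js)) \<and>
       (\<forall>js i. \<forall>x\<in>S.
          ((\<lambda>t. D js (x + t *\<^sub>R axis i 1)) has_real_derivative D (i # js) x) (at 0)))"

text \<open>On an arbitrary set (here: a relatively open subset of a half space) smoothness means
  local extendability to a smooth function on an open set.\<close>

definition smooth_on :: "(real^'d::finite) set \<Rightarrow> (real^'d \<Rightarrow> real) \<Rightarrow> bool" where
  "smooth_on S f \<longleftrightarrow>
    (\<forall>x\<in>S. \<exists>U h. open U \<and> x \<in> U \<and> smooth_open U h \<and> (\<forall>y\<in>U \<inter> S. h y = f y))"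

definition partial_deriv ::
  "(real^'d::finite) set \<Rightarrow> 'd \<Rightarrow> (real^'d \<Rightarrow> real) \<Rightarrow> real^'d \<Rightarrow> real" where
  "partial_deriv S i f x = frechet_derivative f (at x within S) (axis i 1)"


section \<open>Compact connected oriented Riemannian manifolds, possibly with boundary\<close>

text \<open>The manifold is the whole type \<open>'m\<close>; its dimension is \<open>CARD('d)\<close>. A chart is a pair of
  its domain and its coordinate map. Charts take values in one of the two half spaces bounded by
  the hyperplane \<open>x $ bd_coord = 0\<close>; both half spaces are allowed because in dimension one an
  oriented atlas of an interval needs both of them. Since images of charts are relatively open,
  a point of the manifold is a boundary point iff a chart sends it into the hyperplane.\<close>

type_synonym ('m, 'd) chart = "'m set \<times> ('m \<Rightarrow> real^'d)"

definition bd_coord :: "'d::finite" where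
  "bd_coord = (SOME i. True)"

definition chart_image :: "('m, 'd::finite) chart \<Rightarrow> (real^'d) set" where
  "chart_image c = snd c ` fst c"

definition chart_inv :: "('m, 'd::finite) chart \<Rightarrow> real^'d \<Rightarrow> 'm" where
  "chart_inv c = inv_into (fst c) (snd c)"

definition is_chart :: "('m::topological_space, 'd::finite) chart \<Rightarrow> bool" where
  "is_chart c \<longleftrightarrow>
    open (fst c) \<and>
    homeomorphism (fst c) (chart_image c) (snd c) (chart_inv c) \<and>
    (openin (top_of_set {x. 0 \<le> x $ bd_coord}) (chart_image c) \<or>
     openin (top_of_set {x. x $ bd_coord \<le> 0}) (chart_image c))"

definition transition :: "('m, 'd::finite) chart \<Rightarrow> ('m, 'd) chart \<Rightarrow> real^'d \<Rightarrow> real^'d" where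
  "transition c c' x = snd c' (chart_inv c x)"

definition transition_jacobian ::
  "('m, 'd::finite) chart \<Rightarrow> ('m, 'd) chart \<Rightarrow> 'm \<Rightarrow> real^'d^'d" where
  "transition_jacobian c c' p =
     matrix (frechet_derivative (transition c c')
       (at (snd c p) within snd c ` (fst c \<inter> fst c')))"

definition oriented_atlas :: "('m::topological_space, 'd::finite) chart set \<Rightarrow> bool" where
  "oriented_atlas A \<longleftrightarrow>
    (\<forall>c\<in>A. is_chart c) \<and>
    (\<Union>c\<in>A. fst c) = UNIV \<and>
    (\<forall>c\<in>A. \<forall>c'\<in>A. \<forall>i. smooth_on (snd c ` (fst c \<inter> fst c')) (\<lambda>x. transition c c' x $ i)) \<and>
    (\<forall>c\<in>A. \<forall>c'\<in>A. \<forall>p\<in>fst c \<inter> fst c'. 0 < det (transition_jacobian c c' p))"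

definition manifold_boundary :: "('m, 'd::finite) chart set \<Rightarrow> 'm set" where
  "manifold_boundary A = {p. \<exists>c\<in>A. p \<in> fst c \<and> snd c p $ bd_coord = 0}"

text \<open>\<open>g c p\<close> is the matrix \<open>(g\<^sub>i\<^sub>j)\<close> of the metric at the point \<open>p\<close> in the chart \<open>c\<close>.\<close>

type_synonym ('m, 'd) metric_field = "('m, 'd) chart \<Rightarrow> 'm \<Rightarrow> real^'d^'d"

definition riemannian_metric ::
  "('m::topological_space, 'd::finite) chart set \<Rightarrow> ('m, 'd) metric_field \<Rightarrow> bool" where
  "riemannian_metric A g \<longleftrightarrow>
    (\<forall>c\<in>A. \<forall>p\<in>fst c. transpose (g c p) = g c p \<and> (\<forall>v. v \<noteq> 0 \<longrightarrow> 0 < v \<bullet> (g c p *v v))) \<and>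
    (\<forall>c\<in>A. \<forall>i j. smooth_on (chart_image c) (\<lambda>x. g c (chart_inv c x) $ i $ j)) \<and>
    (\<forall>c\<in>A. \<forall>c'\<in>A. \<forall>p\<in>fst c \<inter> fst c'.
       g c p = transpose (transition_jacobian c c' p) ** g c' p ** transition_jacobian c c' p)"

definition compact_oriented_riemannian_manifold ::
  "('m::{t2_space,second_countable_topology}, 'd::finite) chart set \<Rightarrow>
   ('m, 'd) metric_field \<Rightarrow> bool" where
  "compact_oriented_riemannian_manifold A g \<longleftrightarrow>
    compact (UNIV :: 'm set) \<and> connected (UNIV :: 'm set) \<and>
    oriented_atlas A \<and> riemannian_metric A g"

text \<open>The Riemannian volume measure is determined by its values \<open>\<integral> \<surd>det g dx\<close> on Borel
  sets contained in a chart domain.\<close>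

definition riemannian_volume ::
  "('m::topological_space, 'd::finite) chart set \<Rightarrow> ('m, 'd) metric_field \<Rightarrow>
   'm measure \<Rightarrow> bool" where
  "riemannian_volume A g vol \<longleftrightarrow>
    sets vol = sets borel \<and>
    (\<forall>c\<in>A. \<forall>B\<in>sets borel. B \<subseteq> fst c \<longrightarrow>
       emeasure vol B =
         (\<integral>\<^sup>+x\<in>snd c ` B. ennreal (sqrt (det (g c (chart_inv c x)))) \<partial>lborel))"


section \<open>The space \<open>L\<^sup>2\<close>\<close>

text \<open>Elements of \<open>L\<^sup>2\<close> are handled through representatives; equality in \<open>L\<^sup>2\<close> is equality
  almost everywhere.\<close>

definition L2 :: "'m measure \<Rightarrow> ('m \<Rightarrow> real) set" where
  "L2 vol = {f \<in> borel_measurable vol. integrable vol (\<lambda>x. (f x)\<^sup>2)}"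

definition L2_inner :: "'m measure \<Rightarrow> ('m \<Rightarrow> real) \<Rightarrow> ('m \<Rightarrow> real) \<Rightarrow> real" where
  "L2_inner vol f h = (\<integral>x. f x * h x \<partial>vol)"

definition L2_norm :: "'m measure \<Rightarrow> ('m \<Rightarrow> real) \<Rightarrow> real" where
  "L2_norm vol f = sqrt (L2_inner vol f f)"

definition orthonormal_basis ::
  "'m measure \<Rightarrow> ('m \<Rightarrow> real) set \<Rightarrow> nat set \<Rightarrow> (nat \<Rightarrow> 'm \<Rightarrow> real) \<Rightarrow> bool" where
  "orthonormal_basis vol V I e \<longleftrightarrow>
    (\<forall>k\<in>I. e k \<in> V) \<and>
    (\<forall>k\<in>I. \<forall>j\<in>I. L2_inner vol (e k) (e j) = (if k = j then 1 else 0)) \<and>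
    (\<forall>f\<in>V. (\<forall>k\<in>I. L2_inner vol f (e k) = 0) \<longrightarrow> (AE x in vol. f x = 0))"

definition L2_subspace :: "'m measure \<Rightarrow> ('m \<Rightarrow> real) set \<Rightarrow> bool" where
  "L2_subspace vol V \<longleftrightarrow>
    V \<subseteq> L2 vol \<and> (\<lambda>x. 0) \<in> V \<and>
    (\<forall>f\<in>V. \<forall>h\<in>V. (\<lambda>x. f x + h x) \<in> V) \<and>
    (\<forall>f\<in>V. \<forall>a. (\<lambda>x. a * f x) \<in> V) \<and>
    (\<forall>f\<in>V. \<forall>h\<in>L2 vol. (AE x in vol. f x = h x) \<longrightarrow> h \<in> V)"

definition L2_has_dim :: "'m measure \<Rightarrow> ('m \<Rightarrow> real) set \<Rightarrow> nat \<Rightarrow> bool" where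
  "L2_has_dim vol V n \<longleftrightarrow>
    (\<exists>b. (\<forall>k\<in>{1..n}. b k \<in> V) \<and>
      (\<forall>a. (AE x in vol. (\<Sum>k=1..n. a k * b k x) = 0) \<longrightarrow> (\<forall>k\<in>{1..n}. a k = 0)) \<and>
      (\<forall>f\<in>V. \<exists>a. AE x in vol. f x = (\<Sum>k=1..n. a k * b k x)))"


section \<open>The Laplace--Beltrami operator and its eigenpairs\<close>

definition smooth_fun ::
  "('m, 'd::finite) chart set \<Rightarrow> ('m \<Rightarrow> real) \<Rightarrow> bool" where
  "smooth_fun A f \<longleftrightarrow> (\<forall>c\<in>A. smooth_on (chart_image c) (f \<circ> chart_inv c))"

text \<open>Components \<open>g\<^sup>i\<^sup>j \<partial>\<^sub>j f\<close> of the gradient of a smooth function in the chart \<open>c\<close>, as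
  functions of the coordinates.\<close>

definition smooth_grad ::
  "('m, 'd::finite) metric_field \<Rightarrow> ('m \<Rightarrow> real) \<Rightarrow> ('m, 'd) chart \<Rightarrow> real^'d \<Rightarrow> real^'d" where
  "smooth_grad g f c x =
     matrix_inv (g c (chart_inv c x)) *v
       (\<chi> j. partial_deriv (chart_image c) j (f \<circ> chart_inv c) x)"

definition laplace_beltrami ::
  "('m, 'd::finite) metric_field \<Rightarrow> ('m \<Rightarrow> real) \<Rightarrow> ('m, 'd) chart \<Rightarrow> 'm \<Rightarrow> real" where
  "laplace_beltrami g f c p =
     (\<Sum>i\<in>UNIV. partial_deriv (chart_image c) i
        (\<lambda>x. sqrt (det (g c (chart_inv c x))) * smooth_grad g f c x $ i) (snd c p))
     / sqrt (det (g c p))"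

datatype boundary_condition = Dirichlet | Neumann

text \<open>In a boundary chart the unit normal is proportional to the gradient of the coordinate
  \<open>bd_coord\<close>; hence the normal derivative of \<open>f\<close> vanishes iff the component \<open>bd_coord\<close> of the
  gradient of \<open>f\<close> does. Both conditions are void when the boundary is empty.\<close>

definition satisfies_bc ::
  "('m, 'd::finite) chart set \<Rightarrow> ('m, 'd) metric_field \<Rightarrow> boundary_condition \<Rightarrow>
   ('m \<Rightarrow> real) \<Rightarrow> bool" where
  "satisfies_bc A g bc f \<longleftrightarrow>
    (case bc of
       Dirichlet \<Rightarrow> (\<forall>p\<in>manifold_boundary A. f p = 0)
     | Neumann \<Rightarrow> (\<forall>c\<in>A. \<forall>p\<in>fst c \<inter> manifold_boundary A. smooth_grad g f c (snd c p) $ bd_coord = 0))"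

text \<open>Eigenfunctions are taken in their smooth representative (elliptic regularity).\<close>

definition laplace_eigenfunction ::
  "('m, 'd::finite) chart set \<Rightarrow> ('m, 'd) metric_field \<Rightarrow> boundary_condition \<Rightarrow>
   real \<Rightarrow> ('m \<Rightarrow> real) \<Rightarrow> bool" where
  "laplace_eigenfunction A g bc l f \<longleftrightarrow>
    smooth_fun A f \<and> satisfies_bc A g bc f \<and>
    (\<forall>c\<in>A. \<forall>p\<in>fst c. - laplace_beltrami g f c p = l * f p)"

text \<open>Indices start at 1; the values at 0 are irrelevant.\<close>

definition laplace_eigenpairs ::
  "('m, 'd::finite) chart set \<Rightarrow> ('m, 'd) metric_field \<Rightarrow> 'm measure \<Rightarrow> boundary_condition \<Rightarrow>
   (nat \<Rightarrow> real) \<Rightarrow> (nat \<Rightarrow> 'm \<Rightarrow> real) \<Rightarrow> nat \<Rightarrow> bool" where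
  "laplace_eigenpairs A g vol bc lam e M0 \<longleftrightarrow>
    (\<forall>k\<ge>1. laplace_eigenfunction A g bc (lam k) (e k)) \<and>
    orthonormal_basis vol (L2 vol) {1..} e \<and>
    0 \<le> lam 1 \<and> (\<forall>k\<ge>1. lam k \<le> lam (Suc k)) \<and>
    finite {k. 1 \<le> k \<and> lam k = 0} \<and> M0 = card {k. 1 \<le> k \<and> lam k = 0} \<and> M0 \<in> {0, 1}"

definition weyl_bounds :: "(nat \<Rightarrow> real) \<Rightarrow> real \<Rightarrow> real \<Rightarrow> real \<Rightarrow> bool" where
  "weyl_bounds lam \<alpha> c C \<longleftrightarrow>
    0 < c \<and> 0 < C \<and>
    (\<forall>j\<ge>1. 0 < lam j \<longrightarrow> c * real j powr \<alpha> \<le> lam j \<and> lam j \<le> C * real j powr \<alpha>)"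


section \<open>The space \<open>H\<^sup>1\<close> and the gradient\<close>

definition eigenfunction_span :: "(nat \<Rightarrow> 'm \<Rightarrow> real) \<Rightarrow> ('m \<Rightarrow> real) set" where
  "eigenfunction_span e = {f. \<exists>N a. f = (\<lambda>x. \<Sum>k=1..N. a k * e k x)}"

definition H1_norm ::
  "'m measure \<Rightarrow> (nat \<Rightarrow> real) \<Rightarrow> (nat \<Rightarrow> 'm \<Rightarrow> real) \<Rightarrow> nat \<Rightarrow> ('m \<Rightarrow> real) \<Rightarrow> real" where
  "H1_norm vol lam e M0 f =
     sqrt ((\<Sum>k=1..M0. (L2_inner vol f (e k))\<^sup>2) +
           (\<Sum>k. lam (k + M0 + 1) * (L2_inner vol f (e (k + M0 + 1)))\<^sup>2))"

text \<open>The completion of the span of the eigenfunctions is realized inside \<open>L\<^sup>2\<close>: as the norm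
  \<open>H1_norm\<close> dominates a multiple of the \<open>L\<^sup>2\<close> norm, it consists of the \<open>L\<^sup>2\<close> limits of sequences
  in the span which are Cauchy for \<open>H1_norm\<close>.\<close>

definition H1_dot ::
  "'m measure \<Rightarrow> (nat \<Rightarrow> real) \<Rightarrow> (nat \<Rightarrow> 'm \<Rightarrow> real) \<Rightarrow> nat \<Rightarrow> ('m \<Rightarrow> real) set" where
  "H1_dot vol lam e M0 =
    {f \<in> L2 vol. \<exists>p :: nat \<Rightarrow> 'm \<Rightarrow> real.
       (\<forall>m. p m \<in> eigenfunction_span e) \<and>
       (\<forall>\<epsilon>>0. \<exists>M. \<forall>m\<ge>M. \<forall>m'\<ge>M. H1_norm vol lam e M0 (\<lambda>x. p m x - p m' x) < \<epsilon>) \<and>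
       (\<lambda>m. L2_norm vol (\<lambda>x. p m x - f x)) \<longlonglongrightarrow> 0}"

text \<open>A vector field is given by its components \<open>X c p\<close> at the point \<open>p\<close> in every chart \<open>c\<close>.\<close>

definition vector_field ::
  "('m::topological_space, 'd::finite) chart set \<Rightarrow>
   (('m, 'd) chart \<Rightarrow> 'm \<Rightarrow> real^'d) \<Rightarrow> bool" where
  "vector_field A X \<longleftrightarrow>
    (\<forall>c\<in>A. (\<lambda>p. indicator (fst c) p *\<^sub>R X c p) \<in> borel_measurable borel) \<and>
    (\<forall>c\<in>A. \<forall>c'\<in>A. \<forall>p\<in>fst c \<inter> fst c'. X c' p = transition_jacobian c c' p *v X c p)"

text \<open>The choice of the chart is immaterial by the transformation rules of \<open>g\<close>, \<open>X\<close> and \<open>Y\<close>.\<close>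

definition metric_inner ::
  "('m, 'd::finite) chart set \<Rightarrow> ('m, 'd) metric_field \<Rightarrow>
   (('m, 'd) chart \<Rightarrow> 'm \<Rightarrow> real^'d) \<Rightarrow> (('m, 'd) chart \<Rightarrow> 'm \<Rightarrow> real^'d) \<Rightarrow> 'm \<Rightarrow> real" where
  "metric_inner A g X Y p =
    (let c = (SOME c. c \<in> A \<and> p \<in> fst c) in X c p \<bullet> (g c p *v Y c p))"

text \<open>Weak gradients: the covector components \<open>(g X)\<^sub>i\<close> are the weak partial derivatives of \<open>f\<close> in
  the interior of every chart.\<close>

definition weak_gradient ::
  "('m::topological_space, 'd::finite) chart set \<Rightarrow> ('m, 'd) metric_field \<Rightarrow> 'm measure \<Rightarrow>
   ('m \<Rightarrow> real) \<Rightarrow> (('m, 'd) chart \<Rightarrow> 'm \<Rightarrow> real^'d) \<Rightarrow> bool" where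
  "weak_gradient A g vol f X \<longleftrightarrow>
    vector_field A X \<and> integrable vol (metric_inner A g X X) \<and>
    (\<forall>c\<in>A. \<forall>\<psi> i.
       smooth_open UNIV \<psi> \<and> compact (closure {x. \<psi> x \<noteq> 0}) \<and>
       closure {x. \<psi> x \<noteq> 0} \<subseteq> interior (chart_image c) \<longrightarrow>
       (LINT x:interior (chart_image c)|lborel. f (chart_inv c x) * partial_deriv UNIV i \<psi> x) =
       - (LINT x:interior (chart_image c)|lborel.
            (g c (chart_inv c x) *v X c (chart_inv c x)) $ i * \<psi> x))"

text \<open>Weak gradients are unique up to null sets.\<close>

definition gradient ::
  "('m::topological_space, 'd::finite) chart set \<Rightarrow> ('m, 'd) metric_field \<Rightarrow> 'm measure \<Rightarrow>
   ('m \<Rightarrow> real) \<Rightarrow> (('m, 'd) chart \<Rightarrow> 'm \<Rightarrow> real^'d)" where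
  "gradient A g vol f = (SOME X. weak_gradient A g vol f X)"

definition gradient_inner ::
  "('m::topological_space, 'd::finite) chart set \<Rightarrow> ('m, 'd) metric_field \<Rightarrow> 'm measure \<Rightarrow>
   ('m \<Rightarrow> real) \<Rightarrow> ('m \<Rightarrow> real) \<Rightarrow> real" where
  "gradient_inner A g vol f h =
     (\<integral>p. metric_inner A g (gradient A g vol f) (gradient A g vol h) p \<partial>vol)"


section \<open>Galerkin discretization\<close>

text \<open>Constant functions are required to lie in the discretization space, except under Dirichlet
  conditions on a nonempty boundary, where they do not belong to \<open>H1_dot\<close>.\<close>

definition galerkin_space ::
  "('m, 'd::finite) chart set \<Rightarrow> 'm measure \<Rightarrow> boundary_condition \<Rightarrow>
   (nat \<Rightarrow> real) \<Rightarrow> (nat \<Rightarrow> 'm \<Rightarrow> real) \<Rightarrow> nat \<Rightarrow> nat \<Rightarrow> ('m \<Rightarrow> real) set \<Rightarrow> bool" where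
  "galerkin_space A vol bc lam e M0 n V \<longleftrightarrow>
    V \<subseteq> H1_dot vol lam e M0 \<and> L2_subspace vol V \<and> L2_has_dim vol V n \<and>
    (bc = Dirichlet \<and> manifold_boundary A \<noteq> {} \<or> (\<forall>a. (\<lambda>x. a) \<in> V))"

text \<open>\<open>L\<close> is the discretized operator \<open>-\<Delta>\<^sub>n\<close> on \<open>V\<close>; it is unique up to null sets.\<close>

definition galerkin_laplacian ::
  "('m::topological_space, 'd::finite) chart set \<Rightarrow> ('m, 'd) metric_field \<Rightarrow> 'm measure \<Rightarrow>
   ('m \<Rightarrow> real) set \<Rightarrow> (('m \<Rightarrow> real) \<Rightarrow> ('m \<Rightarrow> real)) \<Rightarrow> bool" where
  "galerkin_laplacian A g vol V L \<longleftrightarrow>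
    (\<forall>f\<in>V. L f \<in> V \<and> (\<forall>v\<in>V. L2_inner vol (L f) v = gradient_inner A g vol f v))"

definition galerkin_eigenpairs ::
  "('m::topological_space, 'd::finite) chart set \<Rightarrow> ('m, 'd) metric_field \<Rightarrow> 'm measure \<Rightarrow>
   nat \<Rightarrow> ('m \<Rightarrow> real) set \<Rightarrow> (nat \<Rightarrow> real) \<Rightarrow> (nat \<Rightarrow> 'm \<Rightarrow> real) \<Rightarrow> bool" where
  "galerkin_eigenpairs A g vol n V lam e \<longleftrightarrow>
    (\<exists>L. galerkin_laplacian A g vol V L \<and>
         (\<forall>k\<in>{1..n}. AE x in vol. L (e k) x = lam k * e k x)) \<and>
    orthonormal_basis vol V {1..n} e \<and>
    0 \<le> lam 1 \<and> (\<forall>k\<in>{1..<n}. lam k \<le> lam (Suc k))"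

definition discretization_assumption ::
  "'m measure \<Rightarrow> (nat \<Rightarrow> real) \<Rightarrow> (nat \<Rightarrow> 'm \<Rightarrow> real) \<Rightarrow> nat \<Rightarrow>
   (nat \<Rightarrow> nat \<Rightarrow> real) \<Rightarrow> (nat \<Rightarrow> nat \<Rightarrow> 'm \<Rightarrow> real) \<Rightarrow> real \<Rightarrow>
   nat \<Rightarrow> real \<Rightarrow> real \<Rightarrow> real \<Rightarrow> real \<Rightarrow> real \<Rightarrow> real \<Rightarrow> bool" where
  "discretization_assumption vol lam e M0 lam_n e_n \<alpha> N0 C1 C2 l r s q \<longleftrightarrow>
    0 < N0 \<and> 0 < C1 \<and> 0 < C2 \<and> 0 < l \<and> l \<le> 1 \<and> 0 < r \<and> 0 < s \<and> 1 \<le> q \<and>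
    \<alpha> * q \<le> min (2 * s) (r + \<alpha>) \<and>
    (\<forall>n\<ge>N0. \<forall>k\<in>{M0 + 1..n}.
       \<bar>lam_n n k - lam k\<bar> \<le> C1 * lam k powr q * real n powr (- r) \<and>
       (L2_norm vol (\<lambda>x. e_n n k x - e k x))\<^sup>2 \<le> C2 * lam k powr q * real n powr (- 2 * s) \<and>
       l * lam k \<le> lam_n n k)"

text \<open>The discretization assumption gives \<open>lam_n n n \<le> C * n powr \<alpha> + C1 * C powr q * n powr (\<alpha> * q - r)\<close>, for any
  \<open>C\<close> in the upper Weyl bound. If \<open>\<alpha> q < r + \<alpha>\<close>, the second term is negligible and the following
  predicate is true. If \<open>\<alpha> q = r + \<alpha>\<close>, both terms have the same order, the largest discrete
  eigenvalue may exceed \<open>2 C n\<^sup>\<alpha>\<close>, and the exponential Chebyshev estimate is false with an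
  arbitrary Weyl constant: on the interval \<open>[0, \<pi>]\<close> with Neumann conditions take \<open>C = 1\<close>, \<open>q = 2\<close>,
  \<open>r = s = \<alpha> = 2\<close>, \<open>V n\<close> for \<open>n \<ge> 2\<close> spanned by \<open>e\<^sub>1, \<dots>, e\<^sub>n\<^sub>-\<^sub>1\<close> and \<open>(e\<^sub>n + e\<^sub>m) / \<surd>2\<close> with \<open>m = 100 n\<close>,
  \<open>\<gamma> x = 1 / (1 + x)\<close> and \<open>chi = 1 / 2\<close>. If \<open>\<alpha> q = r + \<alpha>\<close>, the Weyl
  constant \<open>K\<close> is therefore required to be large.\<close>

definition large_weyl_constant ::
  "(nat \<Rightarrow> real) \<Rightarrow> real \<Rightarrow> real \<Rightarrow> real \<Rightarrow> real \<Rightarrow> real \<Rightarrow> bool" where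
  "large_weyl_constant lam \<alpha> K C1 r q \<longleftrightarrow>
    \<alpha> * q < r + \<alpha> \<or>
    (\<exists>C>0. (\<forall>j\<ge>1. 0 < lam j \<longrightarrow> lam j \<le> C * real j powr \<alpha>) \<and> C + C1 * C powr q \<le> 2 * K)"


section \<open>Power spectral densities\<close>

text \<open>Derivatives on \<open>[0, \<infinity>)\<close>, one-sided at 0.\<close>

primrec deriv_nonneg :: "nat \<Rightarrow> (real \<Rightarrow> real) \<Rightarrow> real \<Rightarrow> real" where
  "deriv_nonneg 0 f = f"
| "deriv_nonneg (Suc j) f = (\<lambda>x. vector_derivative (deriv_nonneg j f) (at x within {0..}))"

definition total_variation :: "real set \<Rightarrow> (real \<Rightarrow> real) \<Rightarrow> ennreal" where
  "total_variation S f =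
    (SUP xs\<in>{xs. sorted xs \<and> set xs \<subseteq> S}.
       \<Sum>i<length xs - 1. ennreal \<bar>f (xs ! Suc i) - f (xs ! i)\<bar>)"

text \<open>Only the values of \<open>\<gamma>\<close> on \<open>[0, \<infinity>)\<close> matter.\<close>

definition power_spectral_density :: "real \<Rightarrow> nat \<Rightarrow> (real \<Rightarrow> real) \<Rightarrow> bool" where
  "power_spectral_density \<alpha> \<nu> \<gamma> \<longleftrightarrow>
    1 \<le> \<nu> \<and>
    (\<forall>j<\<nu>. deriv_nonneg j \<gamma> differentiable_on {0..} \<and> continuous_on {0..} (deriv_nonneg j \<gamma>)) \<and>
    total_variation {0..} (deriv_nonneg \<nu> \<gamma>) < \<top> \<and>
    (\<gamma> \<longlongrightarrow> 0) at_top \<and>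
    (\<exists>L C \<beta>. 0 < L \<and> 0 < C \<and> 0 < \<beta> \<and> 2 * \<alpha> * \<beta> - 1 > 0 \<and>
       (\<forall>x\<ge>L. \<bar>deriv_nonneg 1 \<gamma> x\<bar> \<le> C * x powr (- (1 + \<beta>))))"


section \<open>Chebyshev approximation\<close>

fun cheb_T :: "nat \<Rightarrow> real \<Rightarrow> real" where
  "cheb_T 0 t = 1"
| "cheb_T (Suc 0) t = t"
| "cheb_T (Suc (Suc k)) t = 2 * t * cheb_T (Suc k) t - cheb_T k t"

definition cheb_coeff :: "(real \<Rightarrow> real) \<Rightarrow> nat \<Rightarrow> real" where
  "cheb_coeff f k = 2 / pi * (LINT t:{-1..1}|lborel. f t * cheb_T k t / sqrt (1 - t\<^sup>2))"

definition cheb_sum :: "nat \<Rightarrow> (real \<Rightarrow> real) \<Rightarrow> real \<Rightarrow> real" where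
  "cheb_sum K f t =
     cheb_coeff f 0 / 2 * cheb_T 0 t + (\<Sum>k=1..K. cheb_coeff f k * cheb_T k t)"

definition cheb_approx :: "(real \<Rightarrow> real) \<Rightarrow> real \<Rightarrow> nat \<Rightarrow> real \<Rightarrow> real" where
  "cheb_approx \<gamma> lmax K x =
     cheb_sum K (\<lambda>t. \<gamma> (lmax * (1 + t) / 2)) (2 * x / lmax - 1)"

text \<open>The open region bounded by the ellipse with foci 0 and \<open>lmax\<close> and semi-major axis
  \<open>lmax / 2 + chi\<close>.\<close>

definition ellipse_region :: "real \<Rightarrow> real \<Rightarrow> complex set" where
  "ellipse_region lmax chi =
     {z. cmod z + cmod (z - complex_of_real lmax) < 2 * (lmax / 2 + chi)}"


section \<open>Discretized random fields\<close>

definition standard_gaussian_weights ::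
  "'w measure \<Rightarrow> nat \<Rightarrow> (nat \<Rightarrow> 'w \<Rightarrow> real) \<Rightarrow> bool" where
  "standard_gaussian_weights P n W \<longleftrightarrow>
    prob_space.indep_vars P (\<lambda>_. borel) W {1..n} \<and>
    (\<forall>k\<in>{1..n}. distributed P lborel (W k) (\<lambda>x. ennreal (std_normal_density x)))"

definition galerkin_field ::
  "nat \<Rightarrow> (nat \<Rightarrow> 'w \<Rightarrow> real) \<Rightarrow> (real \<Rightarrow> real) \<Rightarrow> (nat \<Rightarrow> real) \<Rightarrow> (nat \<Rightarrow> 'm \<Rightarrow> real) \<Rightarrow>
   'w \<Rightarrow> 'm \<Rightarrow> real" where
  "galerkin_field n W \<gamma> lam e \<omega> x = (\<Sum>k=1..n. W k \<omega> * \<gamma> (lam k) * e k x)"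

definition chebyshev_field ::
  "nat \<Rightarrow> nat \<Rightarrow> (nat \<Rightarrow> 'w \<Rightarrow> real) \<Rightarrow> (real \<Rightarrow> real) \<Rightarrow> (nat \<Rightarrow> real) \<Rightarrow> (nat \<Rightarrow> 'm \<Rightarrow> real) \<Rightarrow>
   'w \<Rightarrow> 'm \<Rightarrow> real" where
  "chebyshev_field n K W \<gamma> lam e = galerkin_field n W (cheb_approx \<gamma> (lam n) K) lam e"

definition L2_random_norm ::
  "'w measure \<Rightarrow> 'm measure \<Rightarrow> ('w \<Rightarrow> 'm \<Rightarrow> real) \<Rightarrow> real" where
  "L2_random_norm P vol X = sqrt (\<integral>\<omega>. (L2_norm vol (X \<omega>))\<^sup>2 \<partial>P)"

definition chebyshev_rmse ::
  "'w measure \<Rightarrow> 'm measure \<Rightarrow> nat \<Rightarrow> nat \<Rightarrow> (nat \<Rightarrow> 'w \<Rightarrow> real) \<Rightarrow> (real \<Rightarrow> real) \<Rightarrow>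
   (nat \<Rightarrow> real) \<Rightarrow> (nat \<Rightarrow> 'm \<Rightarrow> real) \<Rightarrow> real" where
  "chebyshev_rmse P vol n K W \<gamma> lam e =
     L2_random_norm P vol
       (\<lambda>\<omega> x. galerkin_field n W \<gamma> lam e \<omega> x - chebyshev_field n K W \<gamma> lam e \<omega> x)"

end

theory Submission
  imports Defs
begin

text \<open>Orthonormality and unit variance of the weights bound the error by \<open>\<surd>n\<close> times the uniform
  error of the Chebyshev approximation on \<open>[0, L]\<close>, \<open>L = lam_n n n\<close>. With \<open>x = L (1 + cos t) / 2\<close> the
  Chebyshev series becomes a cosine series, whose tail is bounded by the sum of its coefficients.

  For (1) the coefficients are integrated by parts \<open>\<nu> + 1\<close> times. The classical estimate
  \<open>2 (L / 2)\<^sup>\<nu> TV / (\<pi> \<nu> (K - \<nu>)\<^sup>\<nu>)\<close> is not enough if \<open>\<alpha> q = r + \<alpha>\<close>, since then only \<open>L \<le> D n\<^sup>\<alpha>\<close>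
  for some constant \<open>D\<close> is known. However, \<open>\<gamma>\<close> does not depend on \<open>n\<close>, so for large \<open>L\<close> almost all of the
  variation of its \<open>\<nu>\<close>-th derivative sits near the end point \<open>x = 0\<close>, where it contributes with a
  factor of order \<open>sin t = O(\<surd>(x / L))\<close>; hence any constant factor is gained for \<open>n\<close> large.

  For (2) the coefficients are contour integrals over circles, the Joukowski map sending the annulus
  to the ellipse; the radius \<open>1 + s\<close> with \<open>s\<^sup>2 = 2 chi / (C_lam n\<^sup>\<alpha>)\<close> gives the stated bound.\<close>

section \<open>Total variation\<close>

abbreviation variation_sum :: "(real \<Rightarrow> real) \<Rightarrow> real list \<Rightarrow> ennreal" where
  "variation_sum f xs \<equiv> \<Sum>i<length xs - 1. ennreal \<bar>f (xs ! Suc i) - f (xs ! i)\<bar>"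

lemma variation_sum_Cons_Cons:
  "variation_sum f (x # y # xs) = ennreal \<bar>f y - f x\<bar> + variation_sum f (y # xs)"
proof -
  have "length (x # y # xs) - 1 = Suc (length (y # xs) - 1)"
    by simp
  then show ?thesis
    by (simp only: sum.lessThan_Suc_shift nth_Cons_0 nth_Cons_Suc)
qed

text \<open>Concatenation adds only the nonnegative jump from the last point of \<open>xs\<close> to
  the first point of \<open>ys\<close>.\<close>

lemma variation_sum_append:
  "variation_sum f xs + variation_sum f ys \<le> variation_sum f (xs @ ys)"
proof (induction xs rule: induct_list012)
  case (2 x)
  then show ?case
    by (cases ys) (simp_all only: append_Cons append_Nil variation_sum_Cons_Cons, simp_all)
next
  case (3 x y zs)
  then show ?case
    using add_left_mono[of "variation_sum f (y # zs) + variation_sum f ys"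
        "variation_sum f ((y # zs) @ ys)" "ennreal \<bar>f y - f x\<bar>"]
    by (simp only: append_Cons variation_sum_Cons_Cons add.assoc)
qed simp

lemma variation_sum_le_total_variation:
  assumes "sorted xs" "set xs \<subseteq> S"
  shows "variation_sum f xs \<le> total_variation S f"
  unfolding total_variation_def using assms by (intro SUP_upper) auto

lemma total_variation_mono:
  assumes "S \<subseteq> T"
  shows "total_variation S f \<le> total_variation T f"
  unfolding total_variation_def using assms by (intro SUP_subset_mono) auto

lemma abs_diff_le_total_variation:
  assumes "x \<le> y" "x \<in> S" "y \<in> S"
  shows "ennreal \<bar>f y - f x\<bar> \<le> total_variation S f"
  using variation_sum_le_total_variation[of "[x, y]" S f] assms by simp

text \<open>A partition in \<open>S\<close> followed by one in \<open>T\<close> is a partition in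
  the union, even when both sets share an end point. The two suprema are then taken one after the
  other.\<close>

lemma total_variation_superadditive:
  assumes "\<And>x y. x \<in> S \<Longrightarrow> y \<in> T \<Longrightarrow> x \<le> y"
  shows "total_variation S f + total_variation T f \<le> total_variation (S \<union> T) f"
proof -
  let ?Q = "\<lambda>S. {xs. sorted xs \<and> set xs \<subseteq> S}"
  have ne: "?Q X \<noteq> {}" for X :: "real set"
    by (auto intro!: exI[of _ "[]"])
  have "variation_sum f xs + variation_sum f ys \<le> total_variation (S \<union> T) f"
    if "xs \<in> ?Q S" "ys \<in> ?Q T" for xs ys
  proof -
    have "sorted (xs @ ys)" "set (xs @ ys) \<subseteq> S \<union> T"
      using that assms by (auto simp: sorted_append subset_iff)
    then show ?thesis
      by (rule order_trans[OF variation_sum_append variation_sum_le_total_variation])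
  qed
  then have "variation_sum f xs + total_variation T f \<le> total_variation (S \<union> T) f"
    if "xs \<in> ?Q S" for xs
    unfolding total_variation_def[of T] using that ne
    by (subst ennreal_SUP_add_right) (auto intro!: SUP_least)
  then show ?thesis
    unfolding total_variation_def[of S] using ne
    by (subst ennreal_SUP_add_left[symmetric]) (auto intro!: SUP_least)
qed

text \<open>Appending \<open>[x, y]\<close> to partitions of \<open>[0, x]\<close> costs at least
  the jump of \<open>f\<close>. Thus the variation on \<open>[0, x]\<close>, as a function of
  \<open>x\<close>, can serve as the monotone majorant \<open>v\<close> in the estimates below;
  finiteness makes the subtraction after \<open>enn2real\<close> meaningful.\<close>

lemma total_variation_increment:
  assumes fin: "total_variation {0..} f < \<top>" and xy: "0 \<le> x" "x \<le> y"
  shows "\<bar>f y - f x\<bar> \<le> enn2real (total_variation {0..y} f) - enn2real (total_variation {0..x} f)"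
proof -
  have fin': "total_variation {0..z} f < \<top>" for z
    using total_variation_mono[of "{0..z}" "{0..}" f] fin by (auto intro: le_less_trans)
  have "ennreal \<bar>f y - f x\<bar> \<le> total_variation {x..y} f"
    using xy by (intro abs_diff_le_total_variation) auto
  then have "total_variation {0..x} f + ennreal \<bar>f y - f x\<bar>
      \<le> total_variation {0..x} f + total_variation {x..y} f"
    by (rule add_left_mono)
  also have "\<dots> \<le> total_variation ({0..x} \<union> {x..y}) f"
    by (rule total_variation_superadditive) auto
  also have "{0..x} \<union> {x..y} = {0..y}"
    using xy by auto
  finally have "enn2real (total_variation {0..x} f + ennreal \<bar>f y - f x\<bar>)
      \<le> enn2real (total_variation {0..y} f)"
    using fin' by (intro enn2real_mono) auto
  then show ?thesis
    using fin' by (subst (asm) enn2real_plus) auto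
qed

lemma total_variation_le_total:
  assumes "total_variation {0..} f < \<top>"
  shows "enn2real (total_variation {0..x} f) \<le> enn2real (total_variation {0..} f)"
  using assms by (intro enn2real_mono total_variation_mono) auto

text \<open>Integration by parts against a function that is only monotone, hence possibly
  discontinuous: the second mean value theorem evaluates the integral with an intermediate point
  \<open>c\<close>, and the difference from the boundary terms is exactly
  \<open>\<psi> c * (p a - p b)\<close>.\<close>

lemma mono_by_parts_bound:
  fixes p \<psi> \<psi>' :: "real \<Rightarrow> real"
  assumes ab: "a \<le> b"
    and p: "\<And>x y. a \<le> x \<Longrightarrow> x \<le> y \<Longrightarrow> y \<le> b \<Longrightarrow> p y \<le> p x"
    and \<psi>: "\<And>x. a \<le> x \<Longrightarrow> x \<le> b \<Longrightarrow> (\<psi> has_vector_derivative \<psi>' x) (at x within {a..b})"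
    and M: "\<And>x. a \<le> x \<Longrightarrow> x \<le> b \<Longrightarrow> \<bar>\<psi> x\<bar> \<le> M"
  shows "\<exists>I. ((\<lambda>x. p x * \<psi>' x) has_integral I) {a..b} \<and>
    \<bar>I - (p b * \<psi> b - p a * \<psi> a)\<bar> \<le> M * (p a - p b)"
proof -
  have int: "(\<psi>' has_integral \<psi> d - \<psi> c) {c..d}" if "a \<le> c" "c \<le> d" "d \<le> b" for c d
  proof (rule fundamental_theorem_of_calculus[OF that(2)])
    fix x assume "x \<in> {c..d}"
    then show "(\<psi> has_vector_derivative \<psi>' x) (at x within {c..d})"
      using that by (intro has_vector_derivative_within_subset[OF \<psi>]) auto
  qed
  have "\<psi>' integrable_on {a..b}"
    using int[of a b] ab by blast
  \<comment> \<open>The second mean value theorem is applied to an increasing function, hence the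
    sign.\<close>
  moreover have "- p x \<le> - p y" if "a \<le> x" "x \<le> y" "y \<le> b" for x y
    using p[OF that] by simp
  ultimately obtain c where c: "c \<in> {a..b}"
    and I: "((\<lambda>x. - p x * \<psi>' x) has_integral
      - p a * integral {a..c} \<psi>' + - p b * integral {c..b} \<psi>') {a..b}"
    using second_mean_value_theorem_full[of \<psi>' a b "\<lambda>x. - p x"] ab by auto
  have eq: "integral {a..c} \<psi>' = \<psi> c - \<psi> a" "integral {c..b} \<psi>' = \<psi> b - \<psi> c"
    using int[of a c] int[of c b] c by (auto intro: integral_unique)
  have "((\<lambda>x. p x * \<psi>' x) has_integral p a * (\<psi> c - \<psi> a) + p b * (\<psi> b - \<psi> c)) {a..b}"
    using has_integral_neg[OF I] unfolding eq by (simp add: algebra_simps)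
  moreover have "\<bar>p a * (\<psi> c - \<psi> a) + p b * (\<psi> b - \<psi> c) - (p b * \<psi> b - p a * \<psi> a)\<bar>
      \<le> M * (p a - p b)"
  proof -
    have "p a * (\<psi> c - \<psi> a) + p b * (\<psi> b - \<psi> c) - (p b * \<psi> b - p a * \<psi> a) = \<psi> c * (p a - p b)"
      by (simp add: algebra_simps)
    then have "\<bar>p a * (\<psi> c - \<psi> a) + p b * (\<psi> b - \<psi> c) - (p b * \<psi> b - p a * \<psi> a)\<bar>
        = \<bar>\<psi> c\<bar> * \<bar>p a - p b\<bar>"
      by (simp only: abs_mult)
    also have "\<dots> \<le> M * (p a - p b)"
      using M[of c] c p[of a b] ab by (intro mult_mono) auto
    finally show ?thesis .
  qed
  ultimately show ?thesis
    by blast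
qed

text \<open>Jordan decomposition \<open>g = (v + g) / 2 - (v - g) / 2\<close> into monotone functions.\<close>

lemma bv_by_parts_bound:
  fixes g v \<psi> \<psi>' :: "real \<Rightarrow> real"
  assumes ab: "a \<le> b"
    and v: "\<And>x y. a \<le> x \<Longrightarrow> x \<le> y \<Longrightarrow> y \<le> b \<Longrightarrow> \<bar>g x - g y\<bar> \<le> v x - v y"
    and \<psi>: "\<And>x. a \<le> x \<Longrightarrow> x \<le> b \<Longrightarrow> (\<psi> has_vector_derivative \<psi>' x) (at x within {a..b})"
    and M: "\<And>x. a \<le> x \<Longrightarrow> x \<le> b \<Longrightarrow> \<bar>\<psi> x\<bar> \<le> M"
  shows "\<exists>I. ((\<lambda>x. g x * \<psi>' x) has_integral I) {a..b} \<and>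
    \<bar>I - (g b * \<psi> b - g a * \<psi> a)\<bar> \<le> M * (v a - v b)"
proof -
  define p where "p = (\<lambda>x. (v x + g x) / 2)"
  define q where "q = (\<lambda>x. (v x - g x) / 2)"
  have p: "p y \<le> p x" and q: "q y \<le> q x" if "a \<le> x" "x \<le> y" "y \<le> b" for x y
    using v[OF that] unfolding p_def q_def by auto
  obtain I where I: "((\<lambda>x. p x * \<psi>' x) has_integral I) {a..b}"
      "\<bar>I - (p b * \<psi> b - p a * \<psi> a)\<bar> \<le> M * (p a - p b)"
    using mono_by_parts_bound[of a b p \<psi> \<psi>' M, OF ab p \<psi> M] by auto
  obtain J where J: "((\<lambda>x. q x * \<psi>' x) has_integral J) {a..b}"
      "\<bar>J - (q b * \<psi> b - q a * \<psi> a)\<bar> \<le> M * (q a - q b)"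
    using mono_by_parts_bound[of a b q \<psi> \<psi>' M, OF ab q \<psi> M] by auto
  have g: "g x = p x - q x" and v: "v x = p x + q x" for x
    unfolding p_def q_def by (auto simp: field_simps)
  have "((\<lambda>x. g x * \<psi>' x) has_integral I - J) {a..b}"
    using has_integral_diff[OF I(1) J(1)] unfolding g by (simp add: algebra_simps)
  moreover have "\<bar>I - J - (g b * \<psi> b - g a * \<psi> a)\<bar> \<le> M * (v a - v b)"
    using I(2) J(2) unfolding g v by (simp add: algebra_simps abs_le_iff)
  ultimately show ?thesis
    by blast
qed

section \<open>Cosine series\<close>

lemma cheb_T_cos: "cheb_T k (cos t) = cos (real k * t)"
proof (induction k rule: induct_nat_012)
  case (ge2 k)
  have "cos (real (Suc (Suc k)) * t) + cos (real k * t) = 2 * cos t * cos (real (Suc k) * t)"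
    using cos_add[of "real (Suc k) * t" t] cos_diff[of "real (Suc k) * t" t]
    by (simp add: algebra_simps)
  then show ?case
    using ge2 by simp
qed simp_all

lemma continuous_on_cheb_T [continuous_intros]: "continuous_on S (cheb_T k)"
  by (induction k rule: induct_nat_012)
    (simp_all add: continuous_intros cong: continuous_on_cong)

text \<open>The gauge integral is used because the fundamental theorem and integration by parts
  apply to it without integrability assumptions on derivatives.\<close>

definition cos_coeff :: "(real \<Rightarrow> real) \<Rightarrow> nat \<Rightarrow> real" where
  "cos_coeff F k = 2 / pi * integral {0..pi} (\<lambda>t. F t * cos (real k * t))"

text \<open>The weight is singular at both end points. The antiderivative
  \<open>K (arccos t)\<close> is nevertheless continuous on the closed interval and differentiable
  inside, which suffices for the fundamental theorem.\<close>

lemma has_integral_cos_substitution: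
  fixes h :: "real \<Rightarrow> real"
  assumes "continuous_on {-1..1} h"
  shows "((\<lambda>t. h t / sqrt (1 - t\<^sup>2)) has_integral integral {0..pi} (\<lambda>t. h (cos t))) {-1..1}"
proof -
  have cont: "continuous_on {0..pi} (\<lambda>t. h (cos t))"
    by (intro continuous_on_compose2[OF assms] continuous_intros) auto
  define K where "K = (\<lambda>x. integral {x..pi} (\<lambda>t. h (cos t)))"
  have contK: "continuous_on {0..pi} K"
    unfolding K_def by (intro indefinite_integral_continuous_1' integrable_continuous_real cont)
  have "((\<lambda>t. h t / sqrt (1 - t\<^sup>2)) has_integral K (arccos 1) - K (arccos (- 1))) {-1..1}"
  proof (rule fundamental_theorem_of_calculus_interior)
    show "continuous_on {-1..1} (\<lambda>t. K (arccos t))"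
      by (intro continuous_on_compose2[OF contK] continuous_intros)
        (auto simp: arccos_lbound arccos_ubound)
    fix x :: real assume x: "x \<in> {-1<..<1}"
    then have ac: "0 < arccos x" "arccos x < pi"
      using arccos_lt_bounded by auto
    have "(K has_real_derivative - h (cos (arccos x))) (at (arccos x) within {0..pi})"
      unfolding K_def using ac by (intro integral_has_real_derivative'[OF cont]) auto
    then have "(K has_real_derivative - h x) (at (arccos x))"
      using ac x by (simp add: at_within_Icc_at)
    then have "((\<lambda>t. K (arccos t)) has_real_derivative - h x * inverse (- sqrt (1 - x\<^sup>2))) (at x)"
      using x by (intro DERIV_chain2[OF _ DERIV_arccos]) auto
    then show "((\<lambda>t. K (arccos t)) has_vector_derivative h x / sqrt (1 - x\<^sup>2)) (at x)"
      by (simp add: has_real_derivative_iff_has_vector_derivative divide_inverse)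
  qed simp
  then show ?thesis
    by (simp add: K_def)
qed

lemma cheb_coeff_eq_cos_coeff:
  assumes f: "continuous_on {-1..1} f"
  shows "cheb_coeff f k = cos_coeff (\<lambda>t. f (cos t)) k"
proof -
  let ?h = "\<lambda>t. f t * cheb_T k t"
  let ?w = "\<lambda>t. ?h t / sqrt (1 - t\<^sup>2)"
  have cont: "continuous_on {-1..1} ?h"
    by (intro continuous_intros f)
  have int: "(?w has_integral integral {0..pi} (\<lambda>t. ?h (cos t))) {-1..1}"
    by (rule has_integral_cos_substitution[OF cont])
  \<comment> \<open>The same substitution for the absolute value yields absolute integrability,
    which lets the gauge integral be read as a Lebesgue integral.\<close>
  have "((\<lambda>t. \<bar>?h t\<bar> / sqrt (1 - t\<^sup>2)) has_integral integral {0..pi} (\<lambda>t. \<bar>?h (cos t)\<bar>)) {-1..1}"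
    by (intro has_integral_cos_substitution continuous_intros cont)
  then have "(\<lambda>t. norm (?w t)) integrable_on {-1..1}"
    by (rule integrable_eq[OF has_integral_integrable]) (auto simp: abs_mult abs_square_le_1)
  then have "?w absolutely_integrable_on {-1..1}"
    using int by (intro absolutely_integrable_onI) auto
  moreover have "(\<lambda>t. indicator {-1..1} t *\<^sub>R ?w t) \<in> borel_measurable lborel"
  proof -
    have "(\<lambda>t. (indicator {-1..1} t *\<^sub>R ?h t) / sqrt (1 - t\<^sup>2)) \<in> borel_measurable borel"
      by (intro borel_measurable_divide borel_measurable_continuous_on_indicator cont
          borel_measurable_sqrt) auto
    then show ?thesis
      by simp
  qed
  ultimately have "set_integrable lborel {-1..1} ?w"
    unfolding set_integrable_def by (simp add: integrable_completion)
  then have "(LINT t:{-1..1}|lborel. ?w t) = integral {0..pi} (\<lambda>t. ?h (cos t))"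
    by (rule set_borel_integral_eq_integral(2)[THEN trans]) (rule integral_unique[OF int])
  then show ?thesis
    by (simp add: cheb_coeff_def cos_coeff_def cheb_T_cos)
qed

definition cos_orthogonal :: "(real \<Rightarrow> real) \<Rightarrow> bool" where
  "cos_orthogonal h \<longleftrightarrow> (\<forall>k. integral {0..pi} (\<lambda>t. h t * cos (real k * t)) = 0)"

text \<open>By the product formula, multiplication by \<open>cos t\<close> turns the frequency
  \<open>k\<close> into the mean of the frequencies \<open>k + 1\<close> and
  \<open>k - 1\<close>.\<close>

lemma cos_orthogonal_mult_cos:
  assumes cont: "continuous_on {0..pi} h" and orth: "cos_orthogonal h"
  shows "cos_orthogonal (\<lambda>t. h t * cos t)"
  unfolding cos_orthogonal_def
proof
  fix k :: nat
  have int: "(\<lambda>t. h t * cos (real j * t)) integrable_on {0..pi}" for j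
    by (intro integrable_continuous_real continuous_intros cont)
  \<comment> \<open>For \<open>k = 0\<close> the frequency \<open>k - 1\<close> is negative; since
    cosine is even, \<open>m = 1\<close> represents it.\<close>
  obtain m :: nat where m: "cos (real m * t) = cos ((real k - 1) * t)" for t
  proof (cases k)
    case 0
    then show ?thesis by (intro that[of 1]) simp
  next
    case (Suc j)
    then show ?thesis by (intro that[of j]) simp
  qed
  have "h t * cos t * cos (real k * t)
      = 1 / 2 * (h t * cos (real (Suc k) * t) + h t * cos (real m * t))" for t
  proof -
    have "real (Suc k) * t = real k * t + t" "(real k - 1) * t = real k * t - t"
      by (simp_all add: algebra_simps)
    then show ?thesis
      unfolding m by (simp only: cos_add cos_diff) (simp add: algebra_simps)
  qed
  then show "integral {0..pi} (\<lambda>t. h t * cos t * cos (real k * t)) = 0"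
    using orth int[of "Suc k"] int[of m] unfolding cos_orthogonal_def
    by (simp only: integral_mult_right integral_add) simp
qed

text \<open>Induction over the polynomial. \<open>h\<close> is generalized because for a product the
  hypothesis on the second factor is applied to \<open>h\<close> times the first factor.\<close>

lemma cos_orthogonal_mult_polynomial:
  fixes u :: "real \<Rightarrow> real"
  assumes "real_polynomial_function u" "continuous_on {0..pi} h" "cos_orthogonal h"
  shows "cos_orthogonal (\<lambda>t. h t * u (cos t))"
  using assms
proof (induction arbitrary: h rule: real_polynomial_function.induct)
  case (linear u)
  then obtain c where u: "u = (\<lambda>x. x * c)"
    by (auto simp: real_bounded_linear)
  have "h t * u (cos t) * cos (real k * t) = c * (h t * cos t * cos (real k * t))" for t k
    by (simp add: u)
  then show ?case
    using cos_orthogonal_mult_cos[OF linear.prems]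
    by (simp only: cos_orthogonal_def integral_mult_right) simp
next
  case (const c)
  have "h t * c * cos (real k * t) = c * (h t * cos (real k * t))" for t k
    by simp
  with const.prems show ?case
    by (simp only: cos_orthogonal_def integral_mult_right) simp
next
  case (add u v)
  have "(\<lambda>t. h t * p (cos t) * cos (real k * t)) integrable_on {0..pi}"
    if "real_polynomial_function p" for p :: "real \<Rightarrow> real" and k
    using that
    by (intro integrable_continuous_real continuous_intros add.prems(1)
        continuous_on_compose2[OF continuous_on_polymonial_function[of p UNIV]])
      (auto simp: real_polynomial_function_eq)
  note this[OF add.hyps(1)] this[OF add.hyps(2)]
  with add.IH[OF add.prems] show ?case
    by (simp add: cos_orthogonal_def distrib_left distrib_right integral_add)
next
  case (mult u v)
  have "continuous_on {0..pi} (\<lambda>t. h t * u (cos t))"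
    using mult.hyps
    by (intro continuous_intros mult.prems(1)
        continuous_on_compose2[OF continuous_on_polymonial_function[of u UNIV]])
      (auto simp: real_polynomial_function_eq)
  from mult.IH(2)[OF this mult.IH(1)[OF mult.prems]] show ?case
    by (simp add: mult.assoc)
qed

text \<open>Completeness of the cosines. A polynomial \<open>u\<close> approximates
  \<open>h (arccos x)\<close> within \<epsilon>, and \<open>h\<close> is orthogonal to
  \<open>u (cos t)\<close>, so the integral of \<open>(h t)\<^sup>2\<close> is at most \<epsilon>
  times that of \<open>\<bar>h t\<bar>\<close>. It therefore vanishes, and continuity gives the
  claim pointwise.\<close>

lemma cos_orthogonal_imp_zero:
  assumes cont: "continuous_on {0..pi} h" and orth: "cos_orthogonal h" and t: "t \<in> {0..pi}"
  shows "h t = 0"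
proof -
  have contH: "continuous_on {-1..1} (\<lambda>x. h (arccos x))"
    by (intro continuous_on_compose2[OF cont] continuous_intros)
      (auto simp: arccos_lbound arccos_ubound)
  have int: "(\<lambda>t. (h t)\<^sup>2) integrable_on {0..pi}" "(\<lambda>t. \<bar>h t\<bar>) integrable_on {0..pi}"
    by (intro integrable_continuous_real continuous_intros cont)+
  let ?B = "integral {0..pi} (\<lambda>t. \<bar>h t\<bar>)"
  have B: "0 \<le> ?B"
    by (intro integral_nonneg int) auto
  have le: "integral {0..pi} (\<lambda>t. (h t)\<^sup>2) \<le> \<epsilon> * ?B" if "\<epsilon> > 0" for \<epsilon>
  proof -
    obtain u where u: "real_polynomial_function u"
        and close: "\<And>x. x \<in> {-1..1} \<Longrightarrow> \<bar>h (arccos x) - u x\<bar> < \<epsilon>"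
      using Stone_Weierstrass_real_polynomial_function[OF compact_Icc contH \<open>\<epsilon> > 0\<close>] by blast
    have contu: "continuous_on {0..pi} (\<lambda>t. h t * u (cos t))"
      using u
      by (intro continuous_intros cont
          continuous_on_compose2[OF continuous_on_polymonial_function[of u UNIV]])
        (auto simp: real_polynomial_function_eq)
    have "integral {0..pi} (\<lambda>t. h t * u (cos t)) = 0"
      using cos_orthogonal_mult_polynomial[OF u cont orth]
      by (auto simp: cos_orthogonal_def dest: spec[of _ 0])
    then have "integral {0..pi} (\<lambda>t. (h t)\<^sup>2)
        = integral {0..pi} (\<lambda>t. (h t)\<^sup>2 - h t * u (cos t))"
      using int contu by (subst integral_diff) (auto intro: integrable_continuous_real)
    also have "\<dots> \<le> integral {0..pi} (\<lambda>t. \<epsilon> * \<bar>h t\<bar>)"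
    proof (intro integral_le)
      fix t assume "t \<in> {0..pi}"
      then have "\<bar>h t - u (cos t)\<bar> < \<epsilon>"
        using close[of "cos t"] by (simp add: arccos_cos)
      then have "\<bar>h t\<bar> * \<bar>h t - u (cos t)\<bar> \<le> \<bar>h t\<bar> * \<epsilon>"
        by (intro mult_left_mono) auto
      then have "\<bar>h t * (h t - u (cos t))\<bar> \<le> \<epsilon> * \<bar>h t\<bar>"
        by (simp add: abs_mult mult.commute)
      then show "(h t)\<^sup>2 - h t * u (cos t) \<le> \<epsilon> * \<bar>h t\<bar>"
        by (simp add: power2_eq_square right_diff_distrib)
    qed (use int contu in \<open>auto intro!: integrable_diff integrable_continuous_real
          continuous_intros cont\<close>)
    finally show ?thesis
      by simp
  qed
  have "integral {0..pi} (\<lambda>t. (h t)\<^sup>2) \<le> 0"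
  proof (rule field_le_epsilon)
    fix \<epsilon> :: real assume "\<epsilon> > 0"
    \<comment> \<open>Dividing by \<open>?B + 1\<close> covers the case
      \<open>?B = 0\<close>.\<close>
    then have "integral {0..pi} (\<lambda>t. (h t)\<^sup>2) \<le> \<epsilon> / (?B + 1) * ?B"
      using B by (intro le) auto
    also have "\<dots> \<le> \<epsilon>"
      using B \<open>\<epsilon> > 0\<close> by (simp add: field_simps)
    finally show "integral {0..pi} (\<lambda>t. (h t)\<^sup>2) \<le> 0 + \<epsilon>"
      by simp
  qed
  moreover have "0 \<le> integral {0..pi} (\<lambda>t. (h t)\<^sup>2)"
    by (intro integral_nonneg int) auto
  ultimately have "integral {0..pi} (\<lambda>t. (h t)\<^sup>2) = 0"
    by simp
  then have "\<forall>t\<in>{0..pi}. (h t)\<^sup>2 = 0"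
    by (subst (asm) integral_eq_0_iff) (auto intro!: continuous_intros cont)
  then show ?thesis
    using t by simp
qed

lemma integral_cos_multiple:
  assumes "n \<noteq> 0"
  shows "integral {0..pi} (\<lambda>t. cos (real_of_int n * t)) = 0"
proof (rule integral_unique)
  have "((\<lambda>t. cos (real_of_int n * t)) has_integral
      sin (real_of_int n * pi) / real_of_int n - sin (real_of_int n * 0) / real_of_int n) {0..pi}"
    by (intro fundamental_theorem_of_calculus)
      (use assms in \<open>auto intro!: derivative_eq_intros
        simp flip: has_real_derivative_iff_has_vector_derivative\<close>)
  then show "((\<lambda>t. cos (real_of_int n * t)) has_integral 0) {0..pi}"
    by (simp add: mult.commute sin_npi_int)
qed

lemma integral_cos_mult_cos:
  "integral {0..pi} (\<lambda>t. cos (real j * t) * cos (real k * t))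
    = (if j = k then if k = 0 then pi else pi / 2 else 0)"
proof -
  \<comment> \<open>The frequencies are integers, as \<open>j - k\<close> may be negative.\<close>
  have eq: "cos (real j * t) * cos (real k * t)
      = 1 / 2 * (cos (real_of_int (int j - int k) * t) + cos (real_of_int (int j + int k) * t))" for t
    using cos_times_cos[of "real j * t" "real k * t"] by (simp add: algebra_simps)
  have int: "(\<lambda>t. cos (a * t)) integrable_on {0..pi}" for a :: real
    by (intro integrable_continuous_real continuous_intros)
  have "integral {0..pi} (\<lambda>t. cos (real j * t) * cos (real k * t))
      = 1 / 2 * (integral {0..pi} (\<lambda>t. cos (real_of_int (int j - int k) * t))
        + integral {0..pi} (\<lambda>t. cos (real_of_int (int j + int k) * t)))"
    unfolding eq using int by (simp only: integral_mult_right integral_add)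
  moreover have "integral {0..pi} (\<lambda>t. cos (real_of_int n * t)) = (if n = 0 then pi else 0)" for n
    using integral_cos_multiple[of n] by auto
  ultimately show ?thesis
    by (simp only:) auto
qed

text \<open>The bound \<open>B\<close>, uniform in \<open>N\<close>, makes the coefficients
  absolutely summable, so the series converges uniformly to a continuous \<open>S\<close>. Since
  \<open>F\<close> and \<open>S\<close> have the same cosine coefficients, they agree, and the error
  is the tail of the series.\<close>

lemma cos_series_error_le:
  assumes cont: "continuous_on {0..pi} F"
    and B: "\<And>N. (\<Sum>k=K+1..N. \<bar>cos_coeff F k\<bar>) \<le> B"
    and t: "t \<in> {0..pi}"
  shows "\<bar>F t - (cos_coeff F 0 / 2 + (\<Sum>k=1..K. cos_coeff F k * cos (real k * t)))\<bar> \<le> B"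
proof -
  \<comment> \<open>\<open>a\<close> absorbs the factor 1/2 of the constant term, so that partial
    sums become plain sums from 0.\<close>
  define a where "a k = (if k = 0 then cos_coeff F 0 / 2 else cos_coeff F k)" for k
  define f where "f = (\<lambda>k t. a k * cos (real k * t))"
  have part: "cos_coeff F 0 / 2 + (\<Sum>k=1..N. cos_coeff F k * cos (real k * t)) = (\<Sum>k<Suc N. f k t)"
    for N t
  proof -
    have "(\<Sum>k<Suc N. f k t) = f 0 t + (\<Sum>k=1..N. f k t)"
      by (simp add: lessThan_Suc_atMost atMost_atLeast0 sum.atLeast_Suc_atMost)
    then show ?thesis
      by (simp add: f_def a_def)
  qed
  have "summable (\<lambda>k. \<bar>a (k + Suc K)\<bar>)"
  proof (rule summableI_nonneg_bounded)
    fix n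
    have "(\<Sum>k<n. \<bar>a (k + Suc K)\<bar>) = (\<Sum>k=K+1..n + K. \<bar>cos_coeff F k\<bar>)"
      by (rule sum.reindex_bij_witness[of _ "\<lambda>k. k - Suc K" "\<lambda>k. k + Suc K"])
        (auto simp: a_def)
    then show "(\<Sum>k<n. \<bar>a (k + Suc K)\<bar>) \<le> B"
      using B by simp
  qed simp
  then have summ: "summable (\<lambda>k. \<bar>a k\<bar>)"
    by (rule iffD1[OF summable_iff_shift])
  define S where "S = (\<lambda>t. \<Sum>k. f k t)"
  have fa: "norm (f k t) \<le> \<bar>a k\<bar>" for k t
    unfolding f_def by (simp add: abs_mult mult_left_le)
  have unif: "uniform_limit {0..pi} (\<lambda>n t. \<Sum>k<n. f k t) S sequentially"
    unfolding S_def using fa summ by (intro Weierstrass_m_test) auto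
  have contf: "continuous_on {0..pi} (\<lambda>t. \<Sum>k<n. f k t)" for n
    unfolding f_def by (intro continuous_intros)
  have contS: "continuous_on {0..pi} S"
    by (rule uniform_limit_theorem[OF _ unif]) (use contf in auto)
  have "cos_orthogonal (\<lambda>t. F t - S t)"
    unfolding cos_orthogonal_def
  proof
    fix m :: nat
    let ?c = "\<lambda>t. cos (real m * t)"
    have "uniform_limit {0..pi} (\<lambda>n t. (\<Sum>k<n. f k t) * ?c t) (\<lambda>t. S t * ?c t) sequentially"
      by (rule uniform_lim_mult[OF unif uniform_limit_const])
        (auto intro!: compact_imp_bounded compact_continuous_image continuous_intros contS)
    then obtain I J where I: "\<And>n. ((\<lambda>t. (\<Sum>k<n. f k t) * ?c t) has_integral I n) {0..pi}"
        and J: "((\<lambda>t. S t * ?c t) has_integral J) {0..pi}" and lim: "I \<longlonglongrightarrow> J"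
      by (rule uniform_limit_integral) (auto intro!: continuous_intros contf)
    \<comment> \<open>By orthogonality the moment of frequency \<open>m\<close> is already exact for
      each partial sum containing that frequency; the limit thus equals the moment of
      \<open>F\<close>.\<close>
    have "I n = integral {0..pi} (\<lambda>t. F t * ?c t)" if "n > m" for n
    proof -
      have int: "(\<lambda>t. cos (real k * t) * ?c t) integrable_on {0..pi}" for k
        by (intro integrable_continuous_real continuous_intros)
      have "I n = integral {0..pi} (\<lambda>t. \<Sum>k<n. a k * (cos (real k * t) * ?c t))"
        using I[of n] by (simp add: integral_unique[symmetric] f_def sum_distrib_right mult.assoc)
      also have "\<dots> = (\<Sum>k<n. a k * integral {0..pi} (\<lambda>t. cos (real k * t) * ?c t))"
        using int by (subst integral_sum) (auto intro!: integrable_on_mult_right)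
      also have "\<dots> = a m * integral {0..pi} (\<lambda>t. cos (real m * t) * ?c t)"
        using that by (subst sum.remove[of _ m]) (auto simp: integral_cos_mult_cos)
      also have "\<dots> = integral {0..pi} (\<lambda>t. F t * ?c t)"
        by (auto simp: integral_cos_mult_cos a_def cos_coeff_def)
      finally show ?thesis .
    qed
    then have "\<forall>\<^sub>F n in sequentially. I n = integral {0..pi} (\<lambda>t. F t * ?c t)"
      using eventually_gt_at_top[of m] by (rule eventually_mono[rotated]) auto
    then have "I \<longlonglongrightarrow> integral {0..pi} (\<lambda>t. F t * ?c t)"
      by (rule tendsto_eventually)
    then have "J = integral {0..pi} (\<lambda>t. F t * ?c t)"
      using lim LIMSEQ_unique by blast
    moreover have "(\<lambda>t. F t * ?c t) integrable_on {0..pi}"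
      by (intro integrable_continuous_real continuous_intros cont)
    ultimately show "integral {0..pi} (\<lambda>t. (F t - S t) * ?c t) = 0"
      using J by (simp add: left_diff_distrib integral_diff has_integral_integrable integral_unique)
  qed
  then have "F t = S t"
    using cos_orthogonal_imp_zero[of "\<lambda>t. F t - S t" t] t cont contS
    by (auto intro!: continuous_intros)
  moreover have "(\<lambda>N. \<Sum>k<Suc N. f k t) \<longlonglongrightarrow> S t"
    using tendsto_uniform_limitI[OF unif t] by (rule LIMSEQ_Suc)
  ultimately have "(\<lambda>N. \<bar>(\<Sum>k<Suc N. f k t) - (\<Sum>k<Suc K. f k t)\<bar>) \<longlonglongrightarrow> \<bar>F t - (\<Sum>k<Suc K. f k t)\<bar>"
    by (intro tendsto_intros) simp
  moreover have "\<bar>(\<Sum>k<Suc N. f k t) - (\<Sum>k<Suc K. f k t)\<bar> \<le> B" if "N \<ge> K" for N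
  proof -
    have "(\<Sum>k<Suc N. f k t) - (\<Sum>k<Suc K. f k t) = (\<Sum>k=K+1..N. f k t)"
    proof -
      have "{..<Suc N} - {..<Suc K} = {K+1..N}"
        by auto
      then show ?thesis
        using that sum_diff[of "{..<Suc N}" "{..<Suc K}" "\<lambda>k. f k t"] by simp
    qed
    also have "\<bar>\<dots>\<bar> \<le> (\<Sum>k=K+1..N. \<bar>a k\<bar>)"
      using fa by (intro order_trans[OF sum_abs] sum_mono) auto
    also have "\<dots> = (\<Sum>k=K+1..N. \<bar>cos_coeff F k\<bar>)"
      by (intro sum.cong) (auto simp: a_def)
    finally show ?thesis
      using B[of N] by linarith
  qed
  ultimately show ?thesis
    unfolding part by (intro LIMSEQ_le_const2) auto
qed

section \<open>Chebyshev approximation and bounded variation\<close>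

lemma affine_nonneg:
  fixes L c :: real
  assumes "L > 0" "- 1 \<le> c"
  shows "0 \<le> L * (1 + c) / 2"
proof -
  have "0 \<le> L * (1 + c)"
    using assms by (intro mult_nonneg_nonneg) auto
  then show ?thesis
    by simp
qed

text \<open>With \<open>x = L * (1 + cos t) / 2\<close> the Chebyshev polynomial of
  \<open>\<gamma>\<close> at \<open>x\<close> is the partial cosine sum at \<open>t\<close>.\<close>

lemma cheb_approx_error_le:
  assumes L: "L > 0" and cont: "continuous_on {0..L} \<gamma>" and x: "x \<in> {0..L}"
    and B: "\<And>N. (\<Sum>k=K+1..N. \<bar>cos_coeff (\<lambda>t. \<gamma> (L * (1 + cos t) / 2)) k\<bar>) \<le> B"
  shows "\<bar>\<gamma> x - cheb_approx \<gamma> L K x\<bar> \<le> B"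
proof -
  let ?f = "\<lambda>t. \<gamma> (L * (1 + t) / 2)"
  define t where "t = arccos (2 * x / L - 1)"
  have bounds: "- 1 \<le> 2 * x / L - 1" "2 * x / L - 1 \<le> 1"
    using x L by (auto simp: field_simps)
  then have t: "t \<in> {0..pi}" "cos t = 2 * x / L - 1"
    unfolding t_def using arccos_lbound arccos_ubound by auto
  have contf: "continuous_on {-1..1} ?f"
  proof (intro continuous_on_compose2[OF cont] continuous_intros)
    show "(\<lambda>t. L * (1 + t) / 2) ` {-1..1} \<subseteq> {0..L}"
    proof safe
      fix t :: real assume "t \<in> {-1..1}"
      then show "L * (1 + t) / 2 \<in> {0..L}"
        using L affine_nonneg[OF L, of t] mult_left_mono[of "1 + t" 2 L] by auto
    qed
  qed auto
  have "continuous_on {0..pi} (\<lambda>t. ?f (cos t))"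
    by (intro continuous_on_compose2[OF contf] continuous_intros) auto
  then have "\<bar>?f (cos t) - (cos_coeff (\<lambda>t. ?f (cos t)) 0 / 2
      + (\<Sum>k=1..K. cos_coeff (\<lambda>t. ?f (cos t)) k * cos (real k * t)))\<bar> \<le> B"
    using B t(1) by (intro cos_series_error_le) auto
  moreover have "?f (cos t) = \<gamma> x"
    unfolding t(2) using L by simp
  ultimately show ?thesis
    unfolding cheb_approx_def cheb_sum_def
    by (simp add: cheb_coeff_eq_cos_coeff[OF contf] cheb_T_cos flip: t(2))
qed

text \<open>Integration by parts, where the sine kills both boundary terms. \<open>F'\<close> is not
  assumed to be continuous; existence of its integral against the sine is part of the
  result.\<close>

lemma integral_deriv_times_sin:
  fixes F F' :: "real \<Rightarrow> real"
  assumes F: "\<And>t. t \<in> {0..pi} \<Longrightarrow> (F has_real_derivative F' t) (at t within {0..pi})"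
  shows "((\<lambda>t. F' t * sin (real k * t)) has_integral
    - (real k * integral {0..pi} (\<lambda>t. F t * cos (real k * t)))) {0..pi}"
proof -
  have cont: "continuous_on {0..pi} F"
    using F DERIV_continuous_on by blast
  have "((\<lambda>t. F' t * sin (real k * t) + real k * (F t * cos (real k * t))) has_integral
      F pi * sin (real k * pi) - F 0 * sin (real k * 0)) {0..pi}"
  proof (rule fundamental_theorem_of_calculus)
    fix t :: real assume "t \<in> {0..pi}"
    then show "((\<lambda>t. F t * sin (real k * t)) has_vector_derivative
        F' t * sin (real k * t) + real k * (F t * cos (real k * t))) (at t within {0..pi})"
      unfolding has_real_derivative_iff_has_vector_derivative[symmetric]
      by (auto intro!: derivative_eq_intros F)
  qed simp
  moreover have "((\<lambda>t. real k * (F t * cos (real k * t))) has_integral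
      real k * integral {0..pi} (\<lambda>t. F t * cos (real k * t))) {0..pi}"
    by (intro has_integral_mult_right integrable_integral integrable_continuous_real
        continuous_intros cont)
  ultimately show ?thesis
    by (rule has_integral_diff[of _ _ _ "\<lambda>t. real k * (F t * cos (real k * t))",
        THEN has_integral_eq_rhs, THEN has_integral_eq[rotated]]) (auto simp: mult.commute[of _ pi])
qed

text \<open>The chain rule is used for derivatives within a set because the argument reaches 0 at
  \<open>t = pi\<close>, where \<open>G\<close> has only a one-sided derivative.\<close>

lemma has_real_derivative_cos_affine:
  assumes L: "L > 0" and G: "\<And>x. x \<ge> 0 \<Longrightarrow> (G has_real_derivative g x) (at x within {0..})"
  shows "((\<lambda>t. G (L * (1 + cos t) / 2)) has_real_derivative
    g (L * (1 + cos t) / 2) * (- (L / 2) * sin t)) (at t within S)"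
proof -
  have nonneg: "0 \<le> L * (1 + cos t) / 2" for t
    by (rule affine_nonneg[OF L cos_ge_minus_one])
  let ?x = "\<lambda>t. L * (1 + cos t) / 2"
  have "(G has_real_derivative g (?x t)) (at (?x t) within ?x ` S)"
    using nonneg by (intro DERIV_subset[OF G]) auto
  moreover have "(?x has_real_derivative - (L / 2) * sin t) (at t within S)"
    by (auto intro!: derivative_eq_intros)
  ultimately show ?thesis
    using DERIV_image_chain[of G "g (?x t)" ?x t S "- (L / 2) * sin t"] unfolding o_def by blast
qed

text \<open>One integration by parts passes from \<open>G\<close> to its derivative at the price of
  a factor \<open>L / (2 * k)\<close>. The \<open>sin t\<close> in the new kernel comes from the
  inner derivative.\<close>

lemma integral_cos_affine_recursion:
  assumes L: "L > 0" and G: "\<And>x. x \<ge> 0 \<Longrightarrow> (G has_real_derivative g x) (at x within {0..})"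
  shows "((\<lambda>t. g (L * (1 + cos t) / 2) * (sin (real k * t) * sin t)) has_integral
    2 * real k / L * integral {0..pi} (\<lambda>t. G (L * (1 + cos t) / 2) * cos (real k * t))) {0..pi}"
  using has_integral_mult_right[OF integral_deriv_times_sin[OF has_real_derivative_cos_affine[OF L G]],
      of "- 2 / L" k] L
  by (simp add: field_simps)

text \<open>Induction with the addition formula. It supplies the factor \<open>sin t\<close> in the
  second bound on the kernel below.\<close>

lemma abs_sin_multiple_le:
  assumes "t \<in> {0..pi}"
  shows "\<bar>sin (real k * t)\<bar> \<le> real k * sin t"
proof (induction k)
  case (Suc k)
  have s: "0 \<le> sin t"
    using assms by (auto intro: sin_ge_zero)
  have "\<bar>sin (real (Suc k) * t)\<bar> = \<bar>sin (real k * t) * cos t + cos (real k * t) * sin t\<bar>"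
    by (simp add: algebra_simps sin_add)
  also have "\<dots> \<le> \<bar>sin (real k * t)\<bar> * \<bar>cos t\<bar> + \<bar>cos (real k * t)\<bar> * \<bar>sin t\<bar>"
    by (metis abs_mult abs_triangle_ineq)
  also have "\<dots> \<le> \<bar>sin (real k * t)\<bar> * 1 + 1 * \<bar>sin t\<bar>"
    by (intro add_mono mult_mono) auto
  finally show ?case
    using Suc s by (simp add: distrib_right)
qed simp

text \<open>Near \<open>x = 0\<close> the factor \<open>2 sin t\<close> in the second bound on the kernel \<open>\<psi>\<close> is small. This makes
  the estimate insensitive to constant factors of \<open>L\<close> once most of the variation of \<open>g\<close> lies
  in \<open>[0, R]\<close> with \<open>R\<close> much smaller than \<open>L\<close>.\<close>

lemma cos_integral_bv_bound:
  fixes G g v :: "real \<Rightarrow> real"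
  assumes L: "L > 0" and R: "0 \<le> R" "R \<le> L"
    and G: "\<And>x. x \<ge> 0 \<Longrightarrow> (G has_real_derivative g x) (at x within {0..})"
    and v: "\<And>x y. 0 \<le> x \<Longrightarrow> x \<le> y \<Longrightarrow> \<bar>g y - g x\<bar> \<le> v y - v x"
    and k: "k \<ge> 2"
  shows "\<bar>integral {0..pi} (\<lambda>t. G (L * (1 + cos t) / 2) * cos (real k * t))\<bar>
    \<le> L / 2 * (v L - v R + 4 * sqrt (R / L) * (v R - v 0)) / (real k * (real k - 1))"
proof -
  let ?x = "\<lambda>t. L * (1 + cos t) / 2"
  let ?A = "integral {0..pi} (\<lambda>t. G (?x t) * cos (real k * t))"
  \<comment> \<open>An antiderivative of \<open>sin (k * t) * sin t\<close> that vanishes at 0 and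
    \<open>pi\<close>; the denominator is nonzero since \<open>k \<ge> 2\<close>.\<close>
  define \<psi> where "\<psi> = (\<lambda>t. (sin (real k * t) * cos t - real k * (cos (real k * t) * sin t))
    / ((real k)\<^sup>2 - 1))"
  define \<psi>' where "\<psi>' = (\<lambda>t. sin (real k * t) * sin t)"
  have k1: "(real k)\<^sup>2 - 1 = (real k - 1) * (real k + 1)"
    by (simp add: power2_eq_square algebra_simps)
  have kpos: "0 < real k - 1" "0 < real k + 1"
    using k by auto
  have \<psi>_deriv: "(\<psi> has_vector_derivative \<psi>' t) (at t within S)" for t S
  proof -
    have "(\<psi> has_real_derivative (((real k)\<^sup>2 - 1) * (sin (real k * t) * sin t)) / ((real k)\<^sup>2 - 1))
        (at t within S)"
      unfolding \<psi>_def using kpos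
      by (intro DERIV_cdivide) (auto intro!: derivative_eq_intros simp: algebra_simps power2_eq_square)
    then show ?thesis
      using kpos unfolding \<psi>'_def k1 has_real_derivative_iff_has_vector_derivative by simp
  qed
  have \<psi>_abs: "\<bar>\<psi> t\<bar> \<le> c / (real k - 1)"
    if "\<bar>sin (real k * t) * cos t - real k * (cos (real k * t) * sin t)\<bar> \<le> c * (real k + 1)" for t c
  proof -
    have "\<bar>\<psi> t\<bar> = \<bar>sin (real k * t) * cos t - real k * (cos (real k * t) * sin t)\<bar>
        / ((real k - 1) * (real k + 1))"
      unfolding \<psi>_def k1 abs_divide abs_mult[of "real k - 1"] using kpos by simp
    also have "\<dots> \<le> c * (real k + 1) / ((real k - 1) * (real k + 1))"
      using that kpos by (intro divide_right_mono) auto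
    also have "\<dots> = c / (real k - 1)"
      using kpos by simp
    finally show ?thesis .
  qed
  \<comment> \<open>Each product is bounded by half the sum of two squares. The four squares add up
    to 2, so the numerator is at most \<open>k\<close>.\<close>
  have \<psi>_le: "\<bar>\<psi> t\<bar> \<le> 1 / (real k - 1)" for t
  proof -
    have le: "\<bar>a\<bar> * \<bar>b\<bar> \<le> (a\<^sup>2 + b\<^sup>2) / 2" for a b :: real
      using sum_squares_bound[of "\<bar>a\<bar>" "\<bar>b\<bar>"] by simp
    have "\<bar>sin (real k * t) * cos t - real k * (cos (real k * t) * sin t)\<bar>
        \<le> \<bar>sin (real k * t) * cos t\<bar> + \<bar>real k * (cos (real k * t) * sin t)\<bar>"
      by (rule abs_triangle_ineq4)
    also have "\<dots> \<le> real k * (\<bar>sin (real k * t)\<bar> * \<bar>cos t\<bar>)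
        + real k * (\<bar>cos (real k * t)\<bar> * \<bar>sin t\<bar>)"
      using k mult_right_mono[of 1 "real k" "\<bar>sin (real k * t)\<bar> * \<bar>cos t\<bar>"]
      by (simp add: abs_mult)
    also have "\<dots> \<le> real k * (((sin (real k * t))\<^sup>2 + (cos t)\<^sup>2) / 2)
        + real k * (((cos (real k * t))\<^sup>2 + (sin t)\<^sup>2) / 2)"
      by (intro add_mono mult_left_mono le) auto
    also have "\<dots> = real k / 2 * (((sin (real k * t))\<^sup>2 + (cos (real k * t))\<^sup>2)
        + ((sin t)\<^sup>2 + (cos t)\<^sup>2))"
    proof -
      have "K * ((a + b) / 2) + K * ((c + d) / 2) = K / 2 * ((a + c) + (d + b))"
        for K a b c d :: real
        by (simp add: field_simps)
      then show ?thesis .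
    qed
    also have "\<dots> = real k"
      by (simp only: sin_cos_squared_add) simp
    finally have "\<bar>sin (real k * t) * cos t - real k * (cos (real k * t) * sin t)\<bar> \<le> 1 * (real k + 1)"
      by (rule order_trans) simp
    then show ?thesis
      by (rule \<psi>_abs)
  qed
  have \<psi>_le_sin: "\<bar>\<psi> t\<bar> \<le> 2 * sin t / (real k - 1)" if t: "t \<in> {0..pi}" for t
  proof -
    have s: "0 \<le> sin t"
      using t by (auto intro: sin_ge_zero)
    have "\<bar>sin (real k * t) * cos t - real k * (cos (real k * t) * sin t)\<bar>
        \<le> \<bar>sin (real k * t) * cos t\<bar> + \<bar>real k * (cos (real k * t) * sin t)\<bar>"
      by (rule abs_triangle_ineq4)
    also have "\<dots> = \<bar>sin (real k * t)\<bar> * \<bar>cos t\<bar> + real k * (\<bar>cos (real k * t)\<bar> * sin t)"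
      using s by (simp add: abs_mult)
    also have "\<dots> \<le> (real k * sin t) * 1 + real k * (1 * sin t)"
      using s abs_sin_multiple_le[OF t, of k] by (intro add_mono mult_mono) auto
    also have "\<dots> \<le> 2 * sin t * (real k + 1)"
      using s by (simp add: algebra_simps)
    finally show ?thesis
      by (rule \<psi>_abs)
  qed
  have \<psi>_ends: "\<psi> 0 = 0" "\<psi> pi = 0"
    unfolding \<psi>_def by (auto simp: mult.commute[of _ pi])
  \<comment> \<open>The angle with argument \<open>R\<close>: angles in \<open>[0, \<theta>]\<close>
    correspond to arguments in \<open>[R, L]\<close>, and angles in \<open>[\<theta>, pi]\<close> to
    arguments in \<open>[0, R]\<close>.\<close>
  define \<theta> where "\<theta> = arccos (2 * R / L - 1)"
  have bounds: "- 1 \<le> 2 * R / L - 1" "2 * R / L - 1 \<le> 1"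
    using R L by (auto simp: field_simps)
  then have \<theta>: "0 \<le> \<theta>" "\<theta> \<le> pi" "?x \<theta> = R"
    unfolding \<theta>_def using arccos_lbound arccos_ubound L by auto
  have sin_le: "sin t \<le> 2 * sqrt (R / L)" if t: "\<theta> \<le> t" "t \<le> pi" for t
  proof -
    have "cos t \<le> cos \<theta>"
      using t \<theta> by (intro cos_monotone_0_pi_le) auto
    then have c: "1 + cos t \<le> 2 * (R / L)"
      unfolding \<theta>_def using bounds by simp
    have "(sin t)\<^sup>2 = (1 - cos t) * (1 + cos t)"
      by (simp add: sin_squared_eq power2_eq_square algebra_simps)
    also have "\<dots> \<le> 2 * (2 * (R / L))"
    proof (rule mult_mono[OF _ c])
      show "1 - cos t \<le> 2" "0 \<le> 1 + cos t"
        using cos_ge_minus_one[of t] by linarith+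
    qed simp
    also have "\<dots> = (2 * sqrt (R / L))\<^sup>2"
      using R L by (simp add: power_mult_distrib)
    finally show ?thesis
      by (rule power2_le_imp_le) (use R L in simp)
  qed
  have anti: "0 \<le> ?x t" "?x t \<le> ?x s" if "0 \<le> s" "s \<le> t" "t \<le> pi" for s t
    using that L cos_monotone_0_pi_le[of s t] affine_nonneg[OF L cos_ge_minus_one[of t]] by auto
  have vv: "\<bar>g (?x s) - g (?x t)\<bar> \<le> v (?x s) - v (?x t)" if "0 \<le> s" "s \<le> t" "t \<le> pi" for s t
    using v[OF anti[OF that]] .
  \<comment> \<open>The crude kernel bound meets the variation beyond \<open>R\<close>, the small
    one the variation up to \<open>R\<close>. In the sum of both pieces the boundary terms at
    \<theta> cancel, and those at 0 and \<open>pi\<close> vanish.\<close>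
  obtain I where I: "((\<lambda>t. g (?x t) * \<psi>' t) has_integral I) {0..\<theta>}"
      "\<bar>I - (g (?x \<theta>) * \<psi> \<theta> - g (?x 0) * \<psi> 0)\<bar> \<le> 1 / (real k - 1) * (v (?x 0) - v (?x \<theta>))"
    using bv_by_parts_bound[of 0 \<theta> "\<lambda>t. g (?x t)" "\<lambda>t. v (?x t)" \<psi> \<psi>' "1 / (real k - 1)"]
      \<theta> vv \<psi>_deriv \<psi>_le by auto
  obtain J where J: "((\<lambda>t. g (?x t) * \<psi>' t) has_integral J) {\<theta>..pi}"
      "\<bar>J - (g (?x pi) * \<psi> pi - g (?x \<theta>) * \<psi> \<theta>)\<bar>
        \<le> 4 * sqrt (R / L) / (real k - 1) * (v (?x \<theta>) - v (?x pi))"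
  proof -
    have "\<bar>\<psi> t\<bar> \<le> 4 * sqrt (R / L) / (real k - 1)" if "\<theta> \<le> t" "t \<le> pi" for t
    proof -
      have "\<bar>\<psi> t\<bar> \<le> 2 * sin t / (real k - 1)"
        using that \<theta> by (intro \<psi>_le_sin) auto
      also have "\<dots> \<le> 4 * sqrt (R / L) / (real k - 1)"
        using sin_le[OF that] kpos by (intro divide_right_mono) auto
      finally show ?thesis .
    qed
    then show ?thesis
      using that bv_by_parts_bound[of \<theta> pi "\<lambda>t. g (?x t)" "\<lambda>t. v (?x t)" \<psi> \<psi>'
          "4 * sqrt (R / L) / (real k - 1)"] \<theta> vv \<psi>_deriv by auto
  qed
  have "((\<lambda>t. g (?x t) * \<psi>' t) has_integral I + J) {0..pi}"
    using has_integral_combine[OF _ _ I(1) J(1)] \<theta> by auto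
  moreover have "((\<lambda>t. g (?x t) * \<psi>' t) has_integral 2 * real k / L * ?A) {0..pi}"
    unfolding \<psi>'_def by (rule integral_cos_affine_recursion[OF L G])
  ultimately have eq: "2 * real k / L * ?A = I + J"
    by (rule has_integral_unique[rotated])
  have "2 * real k / L * \<bar>?A\<bar> = \<bar>2 * real k / L * ?A\<bar>"
    using L by (simp add: abs_mult)
  also have "\<dots> \<le> 1 / (real k - 1) * (v L - v R) + 4 * sqrt (R / L) / (real k - 1) * (v R - v 0)"
    unfolding eq using I(2) J(2) \<theta>(3) \<psi>_ends by (simp add: abs_le_iff)
  also have "\<dots> = (v L - v R + 4 * sqrt (R / L) * (v R - v 0)) / (real k - 1)"
    by (simp add: add_divide_distrib)
  finally have "2 * real k / L * \<bar>?A\<bar> \<le> (v L - v R + 4 * sqrt (R / L) * (v R - v 0)) / (real k - 1)" .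
  then have "L / (2 * real k) * (2 * real k / L * \<bar>?A\<bar>)
      \<le> L / (2 * real k) * ((v L - v R + 4 * sqrt (R / L) * (v R - v 0)) / (real k - 1))"
    using L by (intro mult_left_mono) auto
  also have "L / (2 * real k) * (2 * real k / L * \<bar>?A\<bar>) = \<bar>?A\<bar>"
    using L k by simp
  finally show ?thesis
    by (simp add: field_simps)
qed

text \<open>Induction on the number of derivatives, with the bounded variation estimate as base
  case. Each step trades frequency \<open>k\<close> for \<open>k - 1\<close> and
  \<open>k + 1\<close> and contributes \<open>L / (2 * k)\<close>, which prolongs the falling
  product by one factor.\<close>

lemma cos_integral_smooth_bound:
  fixes D :: "nat \<Rightarrow> real \<Rightarrow> real"
  assumes L: "L > 0" and R: "0 \<le> R" "R \<le> L"
    and D: "\<And>j x. j < m \<Longrightarrow> x \<ge> 0 \<Longrightarrow> (D j has_real_derivative D (Suc j) x) (at x within {0..})"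
    and v: "\<And>x y. 0 \<le> x \<Longrightarrow> x \<le> y \<Longrightarrow> \<bar>D m y - D m x\<bar> \<le> v y - v x"
    and m: "m \<ge> 1" and k: "k > m"
  shows "\<bar>integral {0..pi} (\<lambda>t. D 0 (L * (1 + cos t) / 2) * cos (real k * t))\<bar>
    \<le> (L / 2) ^ m * (v L - v R + 4 * sqrt (R / L) * (v R - v 0)) / (\<Prod>i\<le>m. real k - real i)"
  using m k D v
proof (induction m arbitrary: D k rule: nat_induct_at_least)
  case base
  then show ?case
    using cos_integral_bv_bound[OF L R, of "D 0" "D 1" v k] by simp
next
  case (Suc m)
  let ?B = "v L - v R + 4 * sqrt (R / L) * (v R - v 0)"
  let ?A = "\<lambda>D k. integral {0..pi} (\<lambda>t. D (L * (1 + cos t) / 2) * cos (real k * t))"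
  let ?P = "\<lambda>k. \<Prod>i\<le>m. real k - real i"
  have B: "0 \<le> ?B"
    using Suc.prems(3)[of 0 R] Suc.prems(3)[of R L] R L by auto
  have IH: "\<bar>?A (D 1) j\<bar> \<le> (L / 2) ^ m * ?B / ?P j" if "j > m" for j
    using Suc.IH[of j "\<lambda>j. D (Suc j)"] that Suc.prems by simp
  obtain j where j: "k = Suc j" "j > m"
    using Suc.prems(1) by (cases k) auto
  have contD: "continuous_on {0..} (D 1)"
    using Suc.prems(2)[of 1] Suc.hyps by (intro DERIV_continuous_on) auto
  have cont: "continuous_on {0..pi} (\<lambda>t. D 1 (L * (1 + cos t) / 2))"
    using affine_nonneg[OF L cos_ge_minus_one]
    by (intro continuous_on_compose2[OF contD] continuous_intros) auto
  have int: "(\<lambda>t. D 1 (L * (1 + cos t) / 2) * cos (real i * t)) integrable_on {0..pi}" for i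
    by (intro integrable_continuous_real continuous_intros cont)
  have "D 1 (L * (1 + cos t) / 2) * (sin (real k * t) * sin t)
      = 1 / 2 * (D 1 (L * (1 + cos t) / 2) * cos (real j * t)
          - D 1 (L * (1 + cos t) / 2) * cos (real (Suc k) * t))" for t
  proof -
    have "real j * t = real k * t - t" "real (Suc k) * t = real k * t + t"
      by (simp_all add: j algebra_simps)
    then show ?thesis
      by (simp only: cos_add cos_diff) (simp add: algebra_simps)
  qed
  then have "((\<lambda>t. D 1 (L * (1 + cos t) / 2) * (sin (real k * t) * sin t)) has_integral
      1 / 2 * (?A (D 1) j - ?A (D 1) (Suc k))) {0..pi}"
    by (simp only:) (intro has_integral_mult_right has_integral_diff integrable_integral int)
  moreover have "((\<lambda>t. D 1 (L * (1 + cos t) / 2) * (sin (real k * t) * sin t)) has_integral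
      2 * real k / L * ?A (D 0) k) {0..pi}"
    using Suc.prems(2)[of 0] by (intro integral_cos_affine_recursion[OF L]) auto
  ultimately have "2 * real k / L * ?A (D 0) k = 1 / 2 * (?A (D 1) j - ?A (D 1) (Suc k))"
    by (rule has_integral_unique[rotated])
  then have "?A (D 0) k = L / (4 * real k) * (?A (D 1) j - ?A (D 1) (Suc k))"
    using L j by (simp add: field_simps)
  then have "\<bar>?A (D 0) k\<bar> = L / (4 * real k) * \<bar>?A (D 1) j - ?A (D 1) (Suc k)\<bar>"
    using L by (simp add: abs_mult)
  also have "\<dots> \<le> L / (4 * real k) * ((L / 2) ^ m * ?B / ?P j + (L / 2) ^ m * ?B / ?P (Suc k))"
    using L IH[of j] IH[of "Suc k"] j by (intro mult_left_mono) auto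
  \<comment> \<open>The bound for frequency \<open>k + 1\<close> is at most the one for
    \<open>j = k - 1\<close>. Two equal terms turn the 4 into a 2.\<close>
  also have "\<dots> \<le> L / (4 * real k) * ((L / 2) ^ m * ?B / ?P j + (L / 2) ^ m * ?B / ?P j)"
  proof (intro mult_left_mono add_left_mono divide_left_mono)
    show "?P j \<le> ?P (Suc k)"
      using j by (intro prod_mono) auto
    show "0 < ?P (Suc k) * ?P j"
      using j by (intro mult_pos_pos prod_pos) auto
  qed (use L B in auto)
  also have "\<dots> = (L / 2) ^ Suc m * ?B / (real k * ?P j)"
  proof -
    have half: "L / (4 * K) * (X + X) = L / 2 * X / K" for K X :: real
      by (cases "K = 0") (simp_all add: field_simps)
    have "L / 2 * (a * B / P) / K = L / 2 * a * B / (K * P)" for K a B P :: real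
      by (simp add: mult_ac)
    then show ?thesis
      by (simp only: half power_Suc)
  qed
  also have "real k * ?P j = (\<Prod>i\<le>Suc m. real k - real i)"
    by (simp add: prod.atMost_Suc_shift j del: prod.atMost_Suc)
  finally show ?case .
qed

text \<open>The summands telescope: \<open>G\<close> is the reciprocal of a falling factorial with
  \<open>m\<close> factors, and its backward difference is \<open>m\<close> times the reciprocal of
  one with \<open>m + 1\<close> factors. Each of the \<open>m\<close> factors in \<open>G K\<close>
  is at least \<open>K - m\<close>.\<close>

lemma sum_inverse_falling_le:
  assumes m: "m \<ge> 1" and K: "K > m"
  shows "(\<Sum>k=K+1..N. 1 / (\<Prod>i\<le>m. real k - real i)) \<le> 1 / (real m * (real K - real m) ^ m)"
proof -
  define G where "G k = 1 / (\<Prod>i<m. real k - real i)" for k :: nat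
  have telescope: "1 / (\<Prod>i\<le>m. real (Suc k) - real i) = (G k - G (Suc k)) / real m" if k: "k > m" for k
  proof -
    define Q where "Q = (\<Prod>i<m. real k - real i)"
    have Q: "Q > 0"
      unfolding Q_def using k by (intro prod_pos) auto
    have eq: "(\<Prod>i\<le>m. real (Suc k) - real i) = (real k + 1) * Q"
      unfolding Q_def lessThan_Suc_atMost[symmetric]
      by (simp add: prod.lessThan_Suc_shift add.commute del: prod.lessThan_Suc)
    have "(\<Prod>i\<le>m. real (Suc k) - real i)
        = (\<Prod>i<m. real (Suc k) - real i) * (real (Suc k) - real m)"
      by (simp add: lessThan_Suc_atMost[symmetric])
    then have "(\<Prod>i<m. real (Suc k) - real i) = (real k + 1) * Q / (real (Suc k) - real m)"
      using eq k by (simp add: field_simps)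
    then have G: "G k = 1 / Q" "G (Suc k) = (real k + 1 - real m) / ((real k + 1) * Q)"
      by (simp_all add: G_def Q_def[symmetric] add.commute)
    show ?thesis
    proof -
      have "1 / Q = (real k + 1) / ((real k + 1) * Q)"
        using Q by (simp add: add_nonneg_eq_0_iff)
      then have "G k - G (Suc k) = real m / ((real k + 1) * Q)"
        unfolding G by (simp only: diff_divide_distrib[symmetric]) simp
      then show ?thesis
        unfolding eq using m by simp
    qed
  qed
  have G0: "0 \<le> G k" if "k > m" for k
    unfolding G_def using that by (intro divide_nonneg_nonneg prod_nonneg) auto
  have "(\<Sum>k=K+1..N. 1 / (\<Prod>i\<le>m. real k - real i)) \<le> G K / real m"
  proof (cases "N \<ge> K")
    case True
    then have "(\<Sum>k=K+1..N. 1 / (\<Prod>i\<le>m. real k - real i)) = (G K - G N) / real m"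
    proof (induction N rule: dec_induct)
      case (step N)
      then have "(\<Sum>k=K+1..Suc N. 1 / (\<Prod>i\<le>m. real k - real i))
          = (G K - G N) / real m + (G N - G (Suc N)) / real m"
        using K telescope[of N] by simp
      then show ?case
        by (simp add: diff_divide_distrib)
    qed simp
    then show ?thesis
      using G0[of N] K True by (simp add: divide_right_mono)
  qed (use G0[of K] K in simp)
  also have "G K \<le> 1 / (real K - real m) ^ m"
  proof -
    have "(real K - real m) ^ m = (\<Prod>i<m. real K - real m)"
      by simp
    also have "\<dots> \<le> (\<Prod>i<m. real K - real i)"
      using K by (intro prod_mono) auto
    finally show ?thesis
      unfolding G_def using K by (intro divide_left_mono mult_pos_pos prod_pos) auto
  qed
  finally show ?thesis
    using m by (simp add: divide_right_mono mult.commute)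
qed

text \<open>Sum of the coefficient bounds. The choice \<open>R = 0\<close> gives the classical
  estimate; a positive \<open>R\<close> exploits concentration of the variation near 0.\<close>

lemma cheb_approx_error_bv:
  assumes L: "L > 0" and R: "0 \<le> R" "R \<le> L" and \<nu>: "\<nu> \<ge> 1" and K: "K > \<nu>"
    and diff: "\<And>j. j < \<nu> \<Longrightarrow> deriv_nonneg j \<gamma> differentiable_on {0..}"
    and v: "\<And>x y. 0 \<le> x \<Longrightarrow> x \<le> y \<Longrightarrow>
      \<bar>deriv_nonneg \<nu> \<gamma> y - deriv_nonneg \<nu> \<gamma> x\<bar> \<le> v y - v x"
    and x: "x \<in> {0..L}"
  shows "\<bar>\<gamma> x - cheb_approx \<gamma> L K x\<bar>
    \<le> 2 / pi * (L / 2) ^ \<nu> * (v L - v R + 4 * sqrt (R / L) * (v R - v 0))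
      / (real \<nu> * (real K - real \<nu>) ^ \<nu>)"
proof (rule cheb_approx_error_le[OF L _ x])
  have D: "(deriv_nonneg j \<gamma> has_real_derivative deriv_nonneg (Suc j) \<gamma> y) (at y within {0..})"
    if "j < \<nu>" "y \<ge> 0" for j y
    using diff[OF that(1)] that(2) unfolding differentiable_on_def
    by (auto simp: has_real_derivative_iff_has_vector_derivative vector_derivative_works)
  show "continuous_on {0..L} \<gamma>"
    using differentiable_imp_continuous_on[OF diff[of 0]] \<nu> by (auto intro: continuous_on_subset)
  fix N
  let ?B = "v L - v R + 4 * sqrt (R / L) * (v R - v 0)"
  have B: "0 \<le> ?B"
    using v[of 0 R] v[of R L] R L by auto
  have coeff_le: "\<bar>cos_coeff (\<lambda>t. \<gamma> (L * (1 + cos t) / 2)) k\<bar>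
      \<le> 2 / pi * (L / 2) ^ \<nu> * ?B * (1 / (\<Prod>i\<le>\<nu>. real k - real i))" if "k > \<nu>" for k
    unfolding cos_coeff_def abs_mult
    using mult_left_mono[OF cos_integral_smooth_bound[OF L R, of \<nu> "\<lambda>j. deriv_nonneg j \<gamma>" v k],
        of "2 / pi"] D v \<nu> that
    by simp
  have "(\<Sum>k=K+1..N. \<bar>cos_coeff (\<lambda>t. \<gamma> (L * (1 + cos t) / 2)) k\<bar>)
      \<le> (\<Sum>k=K+1..N. 2 / pi * (L / 2) ^ \<nu> * ?B * (1 / (\<Prod>i\<le>\<nu>. real k - real i)))"
    using K by (intro sum_mono coeff_le) auto
  also have "\<dots> = 2 / pi * (L / 2) ^ \<nu> * ?B * (\<Sum>k=K+1..N. 1 / (\<Prod>i\<le>\<nu>. real k - real i))"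
    by (rule sum_distrib_left[symmetric])
  also have "\<dots> \<le> 2 / pi * (L / 2) ^ \<nu> * ?B * (1 / (real \<nu> * (real K - real \<nu>) ^ \<nu>))"
    using L B by (intro mult_left_mono sum_inverse_falling_le[OF \<nu> K]) auto
  finally show "(\<Sum>k=K+1..N. \<bar>cos_coeff (\<lambda>t. \<gamma> (L * (1 + cos t) / 2)) k\<bar>)
      \<le> 2 / pi * (L / 2) ^ \<nu> * ?B / (real \<nu> * (real K - real \<nu>) ^ \<nu>)"
    by simp
qed

section \<open>Chebyshev approximation of holomorphic functions\<close>

text \<open>The distances to the foci are \<open>L / 4\<close> times
  \<open>\<bar>z + 1\<bar>\<^sup>2 / \<bar>z\<bar>\<close> and
  \<open>\<bar>z - 1\<bar>\<^sup>2 / \<bar>z\<bar>\<close>. By the parallelogram law their sum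
  depends on the modulus of \<open>z\<close> only.\<close>

lemma joukowski_ellipse:
  assumes z: "z \<noteq> 0" and L: "L > 0"
  shows "of_real L * (1 + (z + inverse z) / 2) / 2 \<in> ellipse_region L chi
    \<longleftrightarrow> cmod z + inverse (cmod z) < 2 * (1 + 2 * chi / L)"
proof -
  let ?w = "of_real L * (1 + (z + inverse z) / 2) / 2"
  have eq: "?w = of_real (L / 4) * ((z + 1)\<^sup>2 / z)" "?w - of_real L = of_real (L / 4) * ((z - 1)\<^sup>2 / z)"
    using z by (simp_all add: field_simps power2_eq_square)
  have "cmod ?w = L / 4 * ((cmod (z + 1))\<^sup>2 / cmod z)"
    unfolding eq(1) norm_mult norm_of_real using L by (simp add: norm_divide norm_power)
  moreover have "cmod (?w - of_real L) = L / 4 * ((cmod (z - 1))\<^sup>2 / cmod z)"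
    unfolding eq(2) norm_mult norm_of_real using L by (simp add: norm_divide norm_power)
  ultimately have "cmod ?w + cmod (?w - of_real L) = L / 4 * (((cmod (z + 1))\<^sup>2 + (cmod (z - 1))\<^sup>2) / cmod z)"
    by (simp add: add_divide_distrib distrib_left)
  also have "(cmod (z + 1))\<^sup>2 + (cmod (z - 1))\<^sup>2 = 2 * (cmod z)\<^sup>2 + 2"
    unfolding cmod_power2 by (simp add: power2_eq_square algebra_simps)
  also have "L / 4 * ((2 * (cmod z)\<^sup>2 + 2) / cmod z) = L / 2 * (cmod z + inverse (cmod z))"
    using z by (simp add: field_simps power2_eq_square)
  finally have "?w \<in> ellipse_region L chi
      \<longleftrightarrow> L / 2 * (cmod z + inverse (cmod z)) < 2 * (L / 2 + chi)"
    by (simp only: ellipse_region_def mem_Collect_eq)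
  also have "2 * (L / 2 + chi) = L / 2 * (2 * (1 + 2 * chi / L))"
    using L by (simp add: field_simps)
  finally show ?thesis
    using L by (simp only: mult_less_cancel_left_pos[of "L / 2"] half_gt_zero)
qed

text \<open>Up to the factor \<open>1 / pi\<close> the coefficient is the imaginary part of the
  integral of \<open>\<Gamma> (w z) / z ^ (k + 1)\<close> over the unit circle. The condition on
  \<open>r\<close> puts the closed annulus up to radius \<open>r\<close> into the preimage
  \<open>S\<close> of the ellipse, so the contour can be moved to radius \<open>r\<close>, where the
  standard estimate applies.\<close>

lemma cos_coeff_holomorphic_le:
  fixes \<Gamma> :: "complex \<Rightarrow> complex"
  assumes L: "L > 0" and ext: "\<And>x. x \<ge> 0 \<Longrightarrow> \<Gamma> (of_real x) = of_real (\<gamma> x)"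
    and hol: "\<Gamma> holomorphic_on ellipse_region L chi"
    and M: "\<And>z. z \<in> ellipse_region L chi \<Longrightarrow> cmod (\<Gamma> z) \<le> M"
    and r: "r \<ge> 1" "r + inverse r < 2 * (1 + 2 * chi / L)"
  shows "\<bar>cos_coeff (\<lambda>t. \<gamma> (L * (1 + cos t) / 2)) k\<bar> \<le> 2 * M / r ^ k"
proof -
  let ?F = "\<lambda>t. \<gamma> (L * (1 + cos t) / 2)"
  define a where "a = 1 + 2 * chi / L"
  define w where "w = (\<lambda>z. complex_of_real L * (1 + (z + inverse z) / 2) / 2)"
  define S where "S = {z \<in> - {0 :: complex}. cmod z + inverse (cmod z) < 2 * a}"
  define f where "f = (\<lambda>z. \<Gamma> (w z) / z ^ (k + 1))"
  have wS: "w z \<in> ellipse_region L chi" if "z \<in> S" for z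
    using joukowski_ellipse[of z L chi] L that unfolding w_def S_def a_def by simp
  have "open S"
  proof -
    have "S = - {0} \<inter> (\<lambda>z. cmod z + inverse (cmod z)) -` {..<2 * a}"
      by (auto simp: S_def)
    also have "open \<dots>"
      by (intro continuous_open_preimage continuous_intros) auto
    finally show ?thesis .
  qed
  have f_hol: "f holomorphic_on S"
  proof -
    have "w holomorphic_on S"
      unfolding w_def by (intro holomorphic_intros) (auto simp: S_def)
    then have "(\<Gamma> \<circ> w) holomorphic_on S"
      using hol wS by (intro holomorphic_on_compose_gen[of w S \<Gamma>]) auto
    then show ?thesis
      unfolding f_def o_def by (intro holomorphic_intros) (auto simp: S_def)
  qed
  \<comment> \<open>The map \<open>c + inverse c\<close> increases for \<open>c \<ge> 1\<close>; the
    factored quotient is its increment from \<open>cmod z\<close> to \<open>r\<close>.\<close>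
  have annulus: "z \<in> S" if "1 \<le> cmod z" "cmod z \<le> r" for z
  proof -
    have "0 \<le> (r - cmod z) * (r * cmod z - 1) / (r * cmod z)"
      using that r mult_mono[of 1 r 1 "cmod z"]
      by (intro divide_nonneg_nonneg mult_nonneg_nonneg) auto
    also have "\<dots> = r + inverse r - (cmod z + inverse (cmod z))"
    proof -
      have "(r - c) * (r * c - 1) / (r * c) = r + inverse r - (c + inverse c)" if "c \<ge> 1" for c
        using r(1) that by (simp add: field_simps)
      then show ?thesis
        using that by blast
    qed
    finally have "cmod z + inverse (cmod z) \<le> r + inverse r"
      by simp
    then show ?thesis
      using r(2) that unfolding S_def a_def by auto
  qed
  let ?c = "\<lambda>r. part_circlepath 0 r (- pi) pi"
  have image: "path_image (?c x) \<subseteq> {z. cmod z = x}" if "x \<ge> 1" for x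
    using that path_image_part_circlepath_subset'[of x 0 "- pi" pi] by (auto simp: sphere_def)
  have ends: "cis (- pi) = cis pi"
    by (simp add: complex_eq_iff)
  \<comment> \<open>Points of equal parameter on both circles have the same argument, so the segment
    between them is radial and stays in the annulus.\<close>
  have "homotopic_loops S (?c 1) (?c r)"
  proof (rule homotopic_loops_linear)
    fix t :: real
    let ?e = "exp (\<i> * of_real (linepath (- pi) pi t))"
    show "closed_segment (?c 1 t) (?c r t) \<subseteq> S"
    proof
      fix z assume "z \<in> closed_segment (?c 1 t) (?c r t)"
      then obtain u where u: "0 \<le> u" "u \<le> 1"
          and "z = (1 - u) *\<^sub>R ?c 1 t + u *\<^sub>R ?c r t"
        unfolding closed_segment_def by auto
      then have "z = of_real ((1 - u) + u * r) * ?e"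
        by (simp add: part_circlepath_def scaleR_conv_of_real algebra_simps)
      moreover have "cmod ?e = 1"
        by (rule norm_exp_i_times)
      ultimately have "cmod z = \<bar>(1 - u) + u * r\<bar>"
        by (simp add: norm_mult del: of_real_add of_real_mult of_real_diff)
      moreover have "1 \<le> (1 - u) + u * r" "(1 - u) + u * r \<le> r"
        using u r(1) mult_left_mono[of 1 r u] mult_right_mono[of u 1 "r - 1"]
        by (auto simp: algebra_simps)
      ultimately show "z \<in> S"
        by (intro annulus) auto
    qed
  qed (auto simp: cis_conv_exp[symmetric] ends simp flip: of_real_minus)
  then have eq: "contour_integral (?c 1) f = contour_integral (?c r) f"
    by (rule Cauchy_theorem_homotopic_loops[OF _ \<open>open S\<close> f_hol]) auto
  have integrable: "f contour_integrable_on ?c x" if "1 \<le> x" "x \<le> r" for x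
    using that image[of x] annulus
    by (intro contour_integrable_holomorphic_simple[OF f_hol \<open>open S\<close>]) auto
  define I where "I = contour_integral (?c r) f"
  have "w 1 \<in> ellipse_region L chi"
    using r(1) by (intro wS annulus) auto
  then have M0: "0 \<le> M"
    by (rule order_trans[OF norm_ge_zero M])
  have "cmod I \<le> M / r ^ (k + 1) * r * (pi - (- pi))"
  proof (rule has_contour_integral_bound_part_circlepath)
    show "(f has_contour_integral I) (?c r)"
      unfolding I_def using integrable[of r] r(1) by (intro has_contour_integral_integral) auto
    fix z assume "z \<in> path_image (?c r)"
    then have z: "cmod z = r"
      using image[of r] r(1) by auto
    then have "cmod (\<Gamma> (w z)) \<le> M"
      using annulus[of z] r(1) by (intro M wS) auto
    then show "cmod (f z) \<le> M / r ^ (k + 1)"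
      unfolding f_def using r(1) by (simp add: norm_divide norm_mult norm_power z divide_right_mono)
  qed (use M0 r in auto)
  also have "\<dots> = 2 * pi * M / r ^ k"
    using r(1) by simp
  finally have I_le: "cmod I \<le> 2 * pi * M / r ^ k" .
  have "(f has_contour_integral I) (?c 1)"
    unfolding I_def eq[symmetric] using integrable[of 1] r(1)
    by (intro has_contour_integral_integral) auto
  then have "((\<lambda>t. f (cis t) * \<i> * cis t) has_integral I) {- pi..pi}"
    by (subst (asm) has_contour_integral_part_circlepath_iff) auto
  \<comment> \<open>On the unit circle the integrand is \<open>\<i>\<close> times a real factor
    times \<open>cis (- (k * t))\<close>, so its imaginary part carries the cosine.\<close>
  then have "((\<lambda>t. Im (f (cis t) * \<i> * cis t)) has_integral Im I) {- pi..pi}"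
    by (rule has_integral_linear[OF _ bounded_linear_Im, unfolded o_def])
  moreover have "Im (f (cis t) * \<i> * cis t) = ?F t * cos (real k * t)" for t
  proof -
    have "w (cis t) = of_real (L * (1 + cos t) / 2)"
      unfolding w_def by (simp add: complex_eq_iff)
    then have "\<Gamma> (w (cis t)) = of_real (?F t)"
      using ext[OF affine_nonneg[OF L cos_ge_minus_one[of t]]] by (simp only:)
    then have "f (cis t) * \<i> * cis t = of_real (?F t) * \<i> * (cis t / cis t ^ (k + 1))"
      unfolding f_def by simp
    also have "cis t / cis t ^ (k + 1) = cis (- (real k * t))"
      by (simp only: Complex.DeMoivre cis_divide) (simp add: algebra_simps)
    finally have eq: "f (cis t) * \<i> * cis t = of_real (?F t) * \<i> * cis (- (real k * t))" .
    show ?thesis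
      unfolding eq by simp
  qed
  ultimately have Im: "((\<lambda>t. ?F t * cos (real k * t)) has_integral Im I) {- pi..pi}"
    by simp
  let ?g = "\<lambda>t. ?F t * cos (real k * t)"
  \<comment> \<open>The integrand is even, so both halves agree; the path was parametrized from
    \<open>- pi\<close> for this purpose.\<close>
  have "Im I = integral {- pi..0} ?g + integral {0..pi} ?g"
    using Im by (subst Henstock_Kurzweil_Integration.integral_combine) (auto dest: integral_unique)
  also have "integral {- pi..0} ?g = integral {0..pi} ?g"
    using Henstock_Kurzweil_Integration.integral_reflect_real[of pi 0 ?g] by simp
  finally have "cos_coeff ?F k = Im I / pi"
    unfolding cos_coeff_def by simp
  then have "\<bar>cos_coeff ?F k\<bar> \<le> cmod I / pi"
    using abs_Im_le_cmod[of I] by (simp add: divide_right_mono)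
  also have "\<dots> \<le> 2 * M / r ^ k"
    using I_le by (simp add: field_simps)
  finally show ?thesis .
qed

text \<open>The radius \<open>1 + s\<close> is admissible because its sum with its inverse is below
  \<open>2 + s\<^sup>2\<close>. The coefficient bounds form a geometric series with tail
  \<open>2 / s * M / (1 + s) ^ K\<close>, and \<open>exp (s / 2) \<le> 1 + s\<close> for
  \<open>s \<le> 2\<close>.\<close>

lemma cheb_approx_error_holomorphic:
  fixes \<Gamma> :: "complex \<Rightarrow> complex"
  assumes L: "L > 0" and cont: "continuous_on {0..L} \<gamma>"
    and ext: "\<And>x. x \<ge> 0 \<Longrightarrow> \<Gamma> (of_real x) = of_real (\<gamma> x)"
    and hol: "\<Gamma> holomorphic_on ellipse_region L chi"
    and M: "\<And>z. z \<in> ellipse_region L chi \<Longrightarrow> cmod (\<Gamma> z) \<le> M" "0 \<le> M"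
    and s: "0 < s" "s \<le> 2" "s\<^sup>2 \<le> 4 * chi / L" and x: "x \<in> {0..L}"
  shows "\<bar>\<gamma> x - cheb_approx \<gamma> L K x\<bar> \<le> 2 / s * M * exp (- (s / 2 * real K))"
proof (rule cheb_approx_error_le[OF L cont x])
  fix N
  have "(1 + s) + inverse (1 + s) = 2 + s\<^sup>2 / (1 + s)"
    using s by (simp add: field_simps power2_eq_square)
  also have "\<dots> < 2 + s\<^sup>2"
    using s by (simp add: field_simps)
  finally have r: "(1 + s) + inverse (1 + s) < 2 * (1 + 2 * chi / L)"
    using s(3) by simp
  have "(\<Sum>k=K+1..N. \<bar>cos_coeff (\<lambda>t. \<gamma> (L * (1 + cos t) / 2)) k\<bar>) \<le> (\<Sum>k=K+1..N. 2 * M / (1 + s) ^ k)"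
    using s by (intro sum_mono cos_coeff_holomorphic_le[OF L ext hol M(1)] r) auto
  also have "\<dots> \<le> 2 / s * M / (1 + s) ^ K"
  proof (cases "N \<ge> K")
    case True
    then have "(\<Sum>k=K+1..N. 2 * M / (1 + s) ^ k) = 2 / s * M / (1 + s) ^ K - 2 / s * M / (1 + s) ^ N"
    proof (induction N rule: dec_induct)
      case (step N)
      have "2 * M / (1 + s) ^ Suc N = 2 / s * M / (1 + s) ^ N - 2 / s * M / (1 + s) ^ Suc N"
      proof -
        have "2 / s * M / q - 2 / s * M / ((1 + s) * q) = 2 * M / ((1 + s) * q)" for q
        proof -
          have "2 / s * M / q = 2 / s * M * (1 + s) / ((1 + s) * q)"
            using s by simp
          moreover have "2 / s * M * (1 + s) - 2 / s * M = 2 * M"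
            using s by (simp add: field_simps)
          ultimately show ?thesis
            by (simp only: diff_divide_distrib[symmetric])
        qed
        then show ?thesis
          by simp
      qed
      then show ?case
        using step by simp
    qed simp
    then show ?thesis
      using s M(2) by simp
  qed (use s M(2) in simp)
  also have "\<dots> \<le> 2 / s * M / exp (s / 2 * real K)"
  proof (intro divide_left_mono)
    have "exp (s / 2) \<le> 1 + s / 2 + (s / 2)\<^sup>2"
      using s by (intro exp_bound) auto
    also have "\<dots> \<le> 1 + s"
      using s mult_left_mono[of "s / 2" 1 "s / 2"] unfolding power2_eq_square by linarith
    finally have "exp (s / 2) ^ K \<le> (1 + s) ^ K"
      by (intro power_mono) auto
    then show "exp (s / 2 * real K) \<le> (1 + s) ^ K"
      by (simp only: exp_of_nat2_mult)
  qed (use s M(2) in auto)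
  finally show "(\<Sum>k=K+1..N. \<bar>cos_coeff (\<lambda>t. \<gamma> (L * (1 + cos t) / 2)) k\<bar>)
      \<le> 2 / s * M * exp (- (s / 2 * real K))"
    by (simp only: exp_minus divide_inverse)
qed

section \<open>Mean square error of the fields\<close>

lemma integrable_mult_L2:
  assumes "f \<in> L2 vol" "h \<in> L2 vol"
  shows "integrable vol (\<lambda>x. f x * h x)"
proof (rule Bochner_Integration.integrable_bound)
  show "integrable vol (\<lambda>x. (f x)\<^sup>2 + (h x)\<^sup>2)"
    using assms by (auto simp: L2_def)
  show "(\<lambda>x. f x * h x) \<in> borel_measurable vol"
    using assms by (auto simp: L2_def)
  have "\<bar>f x\<bar> * \<bar>h x\<bar> \<le> (f x)\<^sup>2 + (h x)\<^sup>2" for x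
    using sum_squares_bound[of "\<bar>f x\<bar>" "\<bar>h x\<bar>"] mult_nonneg_nonneg[of "\<bar>f x\<bar>" "\<bar>h x\<bar>"]
    by (simp only: power2_abs) linarith
  then show "AE x in vol. norm (f x * h x) \<le> norm ((f x)\<^sup>2 + (h x)\<^sup>2)"
    by (simp add: abs_mult)
qed

lemma L2_norm_orthonormal_sum:
  assumes V: "V \<subseteq> L2 vol" and e: "orthonormal_basis vol V I e" and I: "finite I"
  shows "(L2_norm vol (\<lambda>x. \<Sum>k\<in>I. c k * e k x))\<^sup>2 = (\<Sum>k\<in>I. (c k)\<^sup>2)"
proof -
  have int: "integrable vol (\<lambda>x. e k x * e j x)" if "k \<in> I" "j \<in> I" for k j
    using that e V by (intro integrable_mult_L2) (auto simp: orthonormal_basis_def)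
  have "L2_inner vol (\<lambda>x. \<Sum>k\<in>I. c k * e k x) (\<lambda>x. \<Sum>k\<in>I. c k * e k x)
      = (\<integral>x. (\<Sum>k\<in>I. \<Sum>j\<in>I. c k * c j * (e k x * e j x)) \<partial>vol)"
    by (simp add: L2_inner_def sum_product mult_ac)
  also have "\<dots> = (\<Sum>k\<in>I. \<Sum>j\<in>I. c k * c j * L2_inner vol (e k) (e j))"
  proof -
    have "(\<integral>x. (\<Sum>k\<in>I. \<Sum>j\<in>I. c k * c j * (e k x * e j x)) \<partial>vol)
        = (\<Sum>k\<in>I. \<integral>x. (\<Sum>j\<in>I. c k * c j * (e k x * e j x)) \<partial>vol)"
      by (intro Bochner_Integration.integral_sum Bochner_Integration.integrable_sum
          integrable_mult_right int)
    also have "\<dots> = (\<Sum>k\<in>I. \<Sum>j\<in>I. \<integral>x. c k * c j * (e k x * e j x) \<partial>vol)"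
      by (intro sum.cong refl Bochner_Integration.integral_sum integrable_mult_right int)
    finally show ?thesis
      by (simp add: L2_inner_def)
  qed
  also have "\<dots> = (\<Sum>k\<in>I. \<Sum>j\<in>I. if k = j then (c k)\<^sup>2 else 0)"
    using e by (intro sum.cong) (auto simp: orthonormal_basis_def power2_eq_square)
  also have "\<dots> = (\<Sum>k\<in>I. (c k)\<^sup>2)"
    using I by simp
  finally show ?thesis
    by (simp add: L2_norm_def L2_inner_def sum_nonneg)
qed

lemma std_normal_second_moment:
  assumes "distributed P lborel X (\<lambda>x. ennreal (std_normal_density x))"
  shows "integrable P (\<lambda>\<omega>. (X \<omega>)\<^sup>2)" "(\<integral>\<omega>. (X \<omega>)\<^sup>2 \<partial>P) = 1"
  using distributed_integrable[OF assms, of "\<lambda>x. x\<^sup>2"] integrable_std_normal_moment[of 2]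
    distributed_integral[OF assms, of "\<lambda>x. x\<^sup>2"] integral_std_normal_moment_even[of 1]
  by (simp_all add: power2_eq_square fact_2)

text \<open>Both fields share their weights, so the difference expands in the orthonormal basis with
  coefficients \<open>W k * d k\<close>. Its squared norm has mean
  \<open>\<Sum>k. (d k)\<^sup>2\<close> because the weights have second moment 1.\<close>

lemma chebyshev_rmse_le:
  assumes V: "V \<subseteq> L2 vol" and e: "orthonormal_basis vol V {1..n} e"
    and W: "standard_gaussian_weights P n W" and n: "n \<ge> 1"
    and err: "\<And>k. k \<in> {1..n} \<Longrightarrow> \<bar>\<gamma> (lam k) - cheb_approx \<gamma> (lam n) K (lam k)\<bar> \<le> E"
  shows "chebyshev_rmse P vol n K W \<gamma> lam e \<le> sqrt (real n) * E"
proof -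
  define d where "d k = \<gamma> (lam k) - cheb_approx \<gamma> (lam n) K (lam k)" for k
  have field: "(\<lambda>x. galerkin_field n W \<gamma> lam e \<omega> x - chebyshev_field n K W \<gamma> lam e \<omega> x)
      = (\<lambda>x. \<Sum>k=1..n. W k \<omega> * d k * e k x)" for \<omega>
    by (simp add: galerkin_field_def chebyshev_field_def d_def sum_subtractf[symmetric] algebra_simps)
  have W': "integrable P (\<lambda>\<omega>. (W k \<omega>)\<^sup>2)" "(\<integral>\<omega>. (W k \<omega>)\<^sup>2 \<partial>P) = 1" if "k \<in> {1..n}" for k
    using W that std_normal_second_moment[of P "W k"] by (auto simp: standard_gaussian_weights_def)
  have "(\<integral>\<omega>. (\<Sum>k=1..n. (W k \<omega>)\<^sup>2 * (d k)\<^sup>2) \<partial>P) = (\<Sum>k=1..n. (d k)\<^sup>2)"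
    using W' by (subst Bochner_Integration.integral_sum) auto
  also have "\<dots> \<le> (\<Sum>k=1..n. E\<^sup>2)"
    using err by (intro sum_mono power2_le_iff_abs_le[THEN iffD2])
      (auto simp: d_def intro: order_trans[OF abs_ge_zero])
  finally have "sqrt (\<integral>\<omega>. (\<Sum>k=1..n. (W k \<omega>)\<^sup>2 * (d k)\<^sup>2) \<partial>P) \<le> sqrt (real n * E\<^sup>2)"
    by simp
  \<comment> \<open>The error bound at index 1, available since \<open>n \<ge> 1\<close>, shows that
    \<open>E\<close> is nonnegative.\<close>
  also have "sqrt (real n * E\<^sup>2) = sqrt (real n) * E"
    using err[of 1] n by (simp add: real_sqrt_mult)
  finally show ?thesis
    unfolding chebyshev_rmse_def L2_random_norm_def field L2_norm_orthonormal_sum[OF V e finite_atLeastAtMost]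
    by (simp add: power_mult_distrib)
qed

section \<open>Size of the largest eigenvalue\<close>

text \<open>A bounded monotone \<open>v\<close> comes close to its supremum at some fixed
  \<open>R\<close>; once \<open>L\<close> is much larger than \<open>R\<close>, the factor
  \<open>sqrt (R / L)\<close> makes the rest small too. As the bound is relative to
  \<open>v L\<close>, the case of supremum 0 is separate.\<close>

lemma concentrated_variation:
  fixes v :: "real \<Rightarrow> real"
  assumes mono: "\<And>x y. 0 \<le> x \<Longrightarrow> x \<le> y \<Longrightarrow> v x \<le> v y" and v0: "0 \<le> v 0"
    and bdd: "\<And>x. 0 \<le> x \<Longrightarrow> v x \<le> T" and \<delta>: "\<delta> > 0"
  shows "\<exists>L0>0. \<forall>L\<ge>L0. \<exists>R. 0 \<le> R \<and> R \<le> L \<and>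
    v L - v R + 4 * sqrt (R / L) * (v R - v 0) \<le> \<delta> * v L"
proof -
  define S where "S = (SUP x\<in>{0..}. v x)"
  have bdd_above: "bdd_above (v ` {0..})"
    using bdd by (intro bdd_aboveI[of _ T]) auto
  have le_S: "v x \<le> S" if "0 \<le> x" for x
    unfolding S_def using that bdd_above by (intro cSUP_upper) auto
  have nonneg: "0 \<le> v x" if "0 \<le> x" for x
    using mono[of 0 x] v0 that by simp
  show ?thesis
  proof (cases "S = 0")
    case True
    then have "v x = 0" if "0 \<le> x" for x
      using le_S[OF that] nonneg[OF that] by simp
    then have "v L - v 0 + 4 * sqrt (0 / L) * (v 0 - v 0) \<le> \<delta> * v L" if "1 \<le> L" for L
      using that by simp
    then show ?thesis
      by (intro exI[of _ 1]) (auto intro!: exI[of _ 0])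
  next
    case False
    then have S: "S > 0"
      using le_S[of 0] v0 by simp
    \<comment> \<open>Both contributions will be at most \<open>\<epsilon> * S\<close>. Since
      \<open>\<epsilon> \<le> 1 / 2\<close> gives \<open>S \<le> 2 * v R\<close>, their sum is at
      most \<open>4 * \<epsilon> * v R\<close>, hence at most \<open>\<delta> * v L\<close>.\<close>
    define \<epsilon> where "\<epsilon> = min (1 / 2) (\<delta> / 4)"
    have \<epsilon>: "0 < \<epsilon>" "\<epsilon> \<le> 1 / 2" "4 * \<epsilon> \<le> \<delta>"
      using \<delta> by (auto simp: \<epsilon>_def)
    have "(1 - \<epsilon>) * S < S"
      using S \<epsilon> by simp
    then obtain R where R: "0 \<le> R" "(1 - \<epsilon>) * S < v R"
      unfolding S_def using bdd_above by (subst (asm) less_cSUP_iff) auto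
    \<comment> \<open>The last summand of the threshold ensures
      \<open>4 * sqrt (R / L) \<le> \<epsilon>\<close>, the others ensure \<open>R \<le> L\<close>
      and positivity.\<close>
    show ?thesis
    proof (rule exI[of _ "1 + R + 16 * R / \<epsilon>\<^sup>2"], intro conjI allI impI)
      show "0 < 1 + R + 16 * R / \<epsilon>\<^sup>2"
        using R by (intro add_pos_nonneg) auto
      fix L assume "1 + R + 16 * R / \<epsilon>\<^sup>2 \<le> L"
      moreover have "0 \<le> 16 * R / \<epsilon>\<^sup>2"
        using R by simp
      ultimately have L: "0 < L" "R \<le> L" "16 * R / \<epsilon>\<^sup>2 \<le> L"
        using R by linarith+
      have "R / L \<le> (\<epsilon> / 4)\<^sup>2"
        using L \<epsilon> by (simp add: field_simps)
      then have sq: "4 * sqrt (R / L) \<le> \<epsilon>"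
        using real_sqrt_le_mono[of "R / L" "(\<epsilon> / 4)\<^sup>2"] \<epsilon> by simp
      have "v R - v 0 \<le> S" "v L \<le> S" "v R \<le> v L"
        using le_S[of R] le_S[of L] mono[of R L] v0 R L by auto
      moreover have "4 * sqrt (R / L) * (v R - v 0) \<le> \<epsilon> * S"
        using sq calculation mono[of 0 R] R \<epsilon> S by (intro mult_mono) auto
      moreover have "\<epsilon> * S \<le> \<epsilon> * (2 * v R)"
      proof (rule mult_left_mono)
        have "1 / 2 * S \<le> (1 - \<epsilon>) * S"
          using \<epsilon> S by (intro mult_right_mono) auto
        then show "S \<le> 2 * v R"
          using R by linarith
      qed (use \<epsilon> in simp)
      moreover have "4 * \<epsilon> * v R \<le> \<delta> * v L"
        using \<epsilon> nonneg[of R] calculation R by (intro mult_mono) auto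
      ultimately have "v L - v R + 4 * sqrt (R / L) * (v R - v 0) \<le> \<delta> * v L"
        using R(2) by (simp add: algebra_simps)
      then show "\<exists>R. 0 \<le> R \<and> R \<le> L \<and> v L - v R + 4 * sqrt (R / L) * (v R - v 0) \<le> \<delta> * v L"
        using R L by blast
    qed
  qed
qed

text \<open>Otherwise the first \<open>n\<close> eigenvalues would all vanish by monotonicity,
  contradicting the multiplicity \<open>M0 < n\<close> of 0.\<close>

lemma laplace_eigenvalue_pos:
  assumes eig: "laplace_eigenpairs A g vol bc lam e M0" and n: "n > M0"
  shows "lam n > 0"
proof (rule ccontr)
  assume neg: "\<not> lam n > 0"
  have step: "0 \<le> lam 1" "\<And>k. k \<ge> 1 \<Longrightarrow> lam k \<le> lam (Suc k)"
    using eig by (auto simp: laplace_eigenpairs_def)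
  have mono: "lam j \<le> lam k" if "1 \<le> j" "j \<le> k" for j k
    using that(2)
  proof (induction k rule: dec_induct)
    case (step m)
    then show ?case
      using \<open>\<And>k. k \<ge> 1 \<Longrightarrow> lam k \<le> lam (Suc k)\<close>[of m] that(1) by linarith
  qed simp
  have "lam k = 0" if "k \<in> {1..n}" for k
    using mono[of 1 k] mono[of k n] step(1) neg that by simp
  then have "{1..n} \<subseteq> {k. 1 \<le> k \<and> lam k = 0}"
    by auto
  then have "n \<le> card {k. 1 \<le> k \<and> lam k = 0}"
    using eig card_mono[of "{k. 1 \<le> k \<and> lam k = 0}" "{1..n}"] by (auto simp: laplace_eigenpairs_def)
  then show False
    using eig n by (auto simp: laplace_eigenpairs_def)
qed

lemma galerkin_eigenvalue_bounds:
  assumes "galerkin_eigenpairs A g vol n V lam e" and k: "k \<in> {1..n}"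
  shows "lam k \<in> {0..lam n}"
proof -
  have step: "0 \<le> lam 1" "\<And>k. k \<in> {1..<n} \<Longrightarrow> lam k \<le> lam (Suc k)"
    using assms(1) by (auto simp: galerkin_eigenpairs_def)
  have mono: "lam i \<le> lam j" if "1 \<le> i" "i \<le> j" "j \<le> n" for i j
    using that(2,3)
  proof (induction j rule: dec_induct)
    case (step m)
    then show ?case
      using \<open>\<And>k. k \<in> {1..<n} \<Longrightarrow> lam k \<le> lam (Suc k)\<close>[of m] that(1) by force
  qed simp
  show ?thesis
    using mono[of 1 k] mono[of k n] step(1) k by simp
qed

text \<open>The discretization assumption at \<open>k = n\<close>, with its error written relative
  to \<open>n powr \<alpha>\<close>. The constant \<open>C\<close> is kept free since any upper Weyl
  constant may be inserted.\<close>

lemma largest_galerkin_eigenvalue_bounds: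
  assumes eig: "laplace_eigenpairs A g vol bc lam e M0"
    and disc: "discretization_assumption vol lam e M0 lam_n e_n \<alpha> N0 C1 C2 l r s q"
    and n: "n \<ge> N0" "n > M0"
    and up: "lam n \<le> C * real n powr \<alpha>" and low: "c * real n powr \<alpha> \<le> lam n"
    and C: "C > 0"
  shows "lam_n n n \<le> (C + C1 * C powr q * real n powr (\<alpha> * q - r - \<alpha>)) * real n powr \<alpha>"
    and "l * c * real n powr \<alpha> \<le> lam_n n n"
proof -
  have pos: "lam n > 0"
    using laplace_eigenvalue_pos[OF eig n(2)] .
  have d: "0 < C1" "0 < l" "1 \<le> q" "\<bar>lam_n n n - lam n\<bar> \<le> C1 * lam n powr q * real n powr (- r)"
      "l * lam n \<le> lam_n n n"
    using disc n by (auto simp: discretization_assumption_def)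
  have "lam n powr q \<le> (C * real n powr \<alpha>) powr q"
    using up pos d(3) by (intro powr_mono2) auto
  also have "\<dots> = C powr q * real n powr (\<alpha> * q)"
    using C by (simp add: powr_mult powr_powr)
  finally have "C1 * lam n powr q * real n powr (- r)
      \<le> C1 * (C powr q * real n powr (\<alpha> * q)) * real n powr (- r)"
    using d(1) by (intro mult_right_mono mult_left_mono) auto
  also have "\<dots> = C1 * C powr q * real n powr (\<alpha> * q - r - \<alpha>) * real n powr \<alpha>"
    by (simp add: mult.assoc powr_add[symmetric])
  finally show "lam_n n n \<le> (C + C1 * C powr q * real n powr (\<alpha> * q - r - \<alpha>)) * real n powr \<alpha>"
    using d(4) up unfolding distrib_right by linarith
  show "l * c * real n powr \<alpha> \<le> lam_n n n"
    unfolding mult.assoc using mult_left_mono[OF low, of l] d(2,5) by linarith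
qed

lemma eventually_const_le_powr:
  assumes "c > 0" "\<alpha> > 0"
  shows "\<forall>\<^sub>F n in sequentially. B \<le> c * real n powr \<alpha>"
proof -
  let ?b = "\<bar>B\<bar> / c"
  have "\<forall>\<^sub>F n in sequentially. ?b powr (1 / \<alpha>) \<le> real n"
    using filterlim_real_sequentially by (simp add: filterlim_at_top)
  then show ?thesis
  proof eventually_elim
    case (elim n)
    then have "(?b powr (1 / \<alpha>)) powr \<alpha> \<le> real n powr \<alpha>"
      using assms by (intro powr_mono2) auto
    then have "?b \<le> real n powr \<alpha>"
      using assms by (simp add: powr_powr)
    then show ?case
      using assms by (simp add: field_simps)
  qed
qed

theorem theorem5p8:
  fixes A :: "('m::{t2_space,second_countable_topology}, 'd::finite) chart set"
    and g :: "('m, 'd) metric_field"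
    and vol :: "'m measure"
    and bc :: boundary_condition
    and lam :: "nat \<Rightarrow> real" and e :: "nat \<Rightarrow> 'm \<Rightarrow> real" and M0 :: nat
    and \<alpha> c_lam C_lam :: real
    and V :: "nat \<Rightarrow> ('m \<Rightarrow> real) set"
    and lam_n :: "nat \<Rightarrow> nat \<Rightarrow> real" and e_n :: "nat \<Rightarrow> nat \<Rightarrow> 'm \<Rightarrow> real"
    and N0 :: nat and C1 C2 l r s q :: real
    and \<gamma> :: "real \<Rightarrow> real" and \<nu> :: nat
    and P :: "'w measure" and W :: "nat \<Rightarrow> nat \<Rightarrow> 'w \<Rightarrow> real"
  assumes manifold: "compact_oriented_riemannian_manifold A g"
    and volume: "riemannian_volume A g vol"
    and eigenpairs: "laplace_eigenpairs A g vol bc lam e M0"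
    and alpha: "\<alpha> = 2 / real CARD('d)"
    and weyl: "weyl_bounds lam \<alpha> c_lam C_lam"
    and galerkin: "\<And>n. n \<ge> 1 \<Longrightarrow> galerkin_space A vol bc lam e M0 n (V n)"
    and galerkin_eig: "\<And>n. n \<ge> 1 \<Longrightarrow> galerkin_eigenpairs A g vol n (V n) (lam_n n) (e_n n)"
    and discretization:
      "discretization_assumption vol lam e M0 lam_n e_n \<alpha> N0 C1 C2 l r s q"
    and psd: "power_spectral_density \<alpha> \<nu> \<gamma>"
    and prob: "prob_space P" "complete_measure P"
    and weights: "\<And>n. n \<ge> 1 \<Longrightarrow> standard_gaussian_weights P n (W n)"
  shows
    "(\<exists>N_Cheb\<ge>1. \<forall>n>N_Cheb. \<forall>K>\<nu>.
        chebyshev_rmse P vol n K (W n) \<gamma> (lam_n n) (e_n n)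
          \<le> 2 * C_lam ^ \<nu> * inverse (pi * real \<nu>)
             * enn2real (total_variation {0..lam_n n n} (deriv_nonneg \<nu> \<gamma>))
             * real n powr (\<alpha> * real \<nu> + 1 / 2) * inverse ((real K - real \<nu>) ^ \<nu>)) \<and>
     (\<forall>chi>0. \<forall>\<Gamma> :: complex \<Rightarrow> complex.
        (\<forall>x\<ge>0. \<Gamma> (complex_of_real x) = complex_of_real (\<gamma> x)) \<and>
        (\<forall>n\<ge>1. \<Gamma> holomorphic_on ellipse_region (lam_n n n) chi) \<and>
        large_weyl_constant lam \<alpha> C_lam C1 r q \<longrightarrow>
        (\<exists>M_Cheb\<ge>1. \<forall>n>M_Cheb. \<forall>K\<ge>1.
           ereal (chebyshev_rmse P vol n K (W n) \<gamma> (lam_n n) (e_n n))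
             \<le> ereal ((2 * C_lam / chi) powr (1 / 2))
                * (SUP z\<in>ellipse_region (lam_n n n) chi. ereal (cmod (\<Gamma> z)))
                * ereal (real n powr ((\<alpha> + 1) / 2)
                    * exp (- ((2 * C_lam / chi) powr (- 1 / 2)
                              * real n powr (- \<alpha> / 2) * real K)))))"
proof -

  \<comment> \<open>Bounds on the largest discrete eigenvalue and reduction to a uniform
    error\<close>
  note disc_def = discretization[unfolded discretization_assumption_def]
  have \<alpha>: "\<alpha> > 0"
    unfolding alpha by simp
  have C: "C_lam > 0" "c_lam > 0"
    and weyl': "\<And>j. j \<ge> 1 \<Longrightarrow> 0 < lam j \<Longrightarrow> c_lam * real j powr \<alpha> \<le> lam j \<and> lam j \<le> C_lam * real j powr \<alpha>"
    using weyl by (auto simp: weyl_bounds_def)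
  have d: "C1 > 0" "l > 0" "\<alpha> * q - r - \<alpha> \<le> 0"
    using disc_def by auto
  have lam_max: "lam_n n n \<le> (C + C1 * C powr q * real n powr (\<alpha> * q - r - \<alpha>)) * real n powr \<alpha>"
      "l * c_lam * real n powr \<alpha> \<le> lam_n n n"
    if n: "n > M0 + N0" and C: "C > 0"
      and up: "\<And>j. j \<ge> 1 \<Longrightarrow> 0 < lam j \<Longrightarrow> lam j \<le> C * real j powr \<alpha>" for n C
  proof -
    have "lam n > 0"
      using laplace_eigenvalue_pos[OF eigenpairs] n by simp
    then show "lam_n n n \<le> (C + C1 * C powr q * real n powr (\<alpha> * q - r - \<alpha>)) * real n powr \<alpha>"
        "l * c_lam * real n powr \<alpha> \<le> lam_n n n"
      using n up[of n] weyl'[of n]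
      by (auto intro!: largest_galerkin_eigenvalue_bounds[OF eigenpairs discretization _ _ _ _ C])
  qed
  have low: "l * c_lam * real n powr \<alpha> \<le> lam_n n n" if "n > M0 + N0" for n
    using lam_max(2)[OF that C(1)] weyl' by blast
  have rmse: "chebyshev_rmse P vol n K (W n) \<gamma> (lam_n n) (e_n n) \<le> sqrt (real n) * E"
    if "n \<ge> 1" and err: "\<And>x. x \<in> {0..lam_n n n} \<Longrightarrow> \<bar>\<gamma> x - cheb_approx \<gamma> (lam_n n n) K x\<bar> \<le> E" for n K E
  proof (rule chebyshev_rmse_le[OF _ _ weights[OF that(1)] that(1)])
    show "V n \<subseteq> L2 vol"
      using galerkin[OF that(1)] by (simp add: galerkin_space_def L2_subspace_def)
    show "orthonormal_basis vol (V n) {1..n} (e_n n)"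
      using galerkin_eig[OF that(1)] by (simp add: galerkin_eigenpairs_def)
    show "\<bar>\<gamma> (lam_n n k) - cheb_approx \<gamma> (lam_n n n) K (lam_n n k)\<bar> \<le> E" if "k \<in> {1..n}" for k
      using galerkin_eigenvalue_bounds[OF galerkin_eig that] that by (intro err) auto
  qed
  have \<nu>: "\<nu> \<ge> 1" and diff: "\<And>j. j < \<nu> \<Longrightarrow> deriv_nonneg j \<gamma> differentiable_on {0..}"
    and tv: "total_variation {0..} (deriv_nonneg \<nu> \<gamma>) < \<top>"
    using psd by (auto simp: power_spectral_density_def)
  have \<gamma>_cont: "continuous_on {0..} \<gamma>"
    using differentiable_imp_continuous_on[OF diff[of 0]] \<nu> by simp
  define v where "v x = enn2real (total_variation {0..x} (deriv_nonneg \<nu> \<gamma>))" for x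
  have v: "\<bar>deriv_nonneg \<nu> \<gamma> y - deriv_nonneg \<nu> \<gamma> x\<bar> \<le> v y - v x" if "0 \<le> x" "x \<le> y" for x y
    unfolding v_def by (rule total_variation_increment[OF tv that])
  have v_nonneg: "0 \<le> v x" for x
    by (simp add: v_def)

  \<comment> \<open>The algebraic rate for derivatives of bounded variation\<close>
  have "\<exists>N_Cheb\<ge>1. \<forall>n>N_Cheb. \<forall>K>\<nu>.
        chebyshev_rmse P vol n K (W n) \<gamma> (lam_n n) (e_n n)
          \<le> 2 * C_lam ^ \<nu> * inverse (pi * real \<nu>) * v (lam_n n n)
             * real n powr (\<alpha> * real \<nu> + 1 / 2) * inverse ((real K - real \<nu>) ^ \<nu>)"
  proof -
    define D where "D = C_lam + C1 * C_lam powr q"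
    have D: "D > 0"
      unfolding D_def using C d by (intro add_pos_nonneg) auto
    \<comment> \<open>Only \<open>L \<le> D * n powr \<alpha>\<close> is known, and \<open>D\<close>
      may exceed \<open>2 * C_lam\<close>. This \<delta> is the factor that turns
      \<open>(D * n powr \<alpha> / 2) ^ \<nu>\<close> into
      \<open>(C_lam * n powr \<alpha>) ^ \<nu>\<close>.\<close>
    define \<delta> where "\<delta> = (2 * C_lam / D) ^ \<nu>"
    have "\<delta> > 0"
      unfolding \<delta>_def using C D by simp
    have v_mono: "v x \<le> v y" if "0 \<le> x" "x \<le> y" for x y
      using v[OF that] by linarith
    have v_bdd: "v x \<le> enn2real (total_variation {0..} (deriv_nonneg \<nu> \<gamma>))" for x
      unfolding v_def by (rule total_variation_le_total[OF tv])
    obtain L0 where L0: "L0 > 0" "\<And>L. L \<ge> L0 \<Longrightarrow> \<exists>R. 0 \<le> R \<and> R \<le> L \<and>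
        v L - v R + 4 * sqrt (R / L) * (v R - v 0) \<le> \<delta> * v L"
      using concentrated_variation[of v, OF v_mono v_nonneg v_bdd \<open>\<delta> > 0\<close>] by auto
    \<comment> \<open>The lower bound on the largest eigenvalue makes it exceed the threshold
      \<open>L0\<close> for all large \<open>n\<close>.\<close>
    obtain N where N: "\<And>n. n \<ge> N \<Longrightarrow> L0 \<le> l * c_lam * real n powr \<alpha>"
      using eventually_const_le_powr[of "l * c_lam" \<alpha> L0] C d \<alpha>
      by (auto simp: eventually_sequentially)
    show ?thesis
    proof (intro exI[of _ "M0 + N0 + N + 1"] conjI allI impI)
      fix n K assume n: "M0 + N0 + N + 1 < n" and K: "\<nu> < K"
      define L where "L = lam_n n n"
      have LD: "L \<le> D * real n powr \<alpha>"
      proof -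
        have "L \<le> (C_lam + C1 * C_lam powr q * real n powr (\<alpha> * q - r - \<alpha>)) * real n powr \<alpha>"
          unfolding L_def using n weyl' by (intro lam_max(1) C) auto
        also have "\<dots> \<le> (C_lam + C1 * C_lam powr q * 1) * real n powr \<alpha>"
          using n d powr_mono[of "\<alpha> * q - r - \<alpha>" 0 "real n"]
          by (intro mult_right_mono add_left_mono mult_left_mono) auto
        finally show ?thesis
          by (simp add: D_def)
      qed
      have "L0 \<le> L"
        using N[of n] low[of n] n unfolding L_def by linarith
      then have L: "L > 0" and "\<exists>R. 0 \<le> R \<and> R \<le> L \<and>
          v L - v R + 4 * sqrt (R / L) * (v R - v 0) \<le> \<delta> * v L"
        using L0 by auto
      then obtain R where R: "0 \<le> R" "R \<le> L"
          and B: "v L - v R + 4 * sqrt (R / L) * (v R - v 0) \<le> \<delta> * v L"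
        by blast
      let ?Q = "real \<nu> * (real K - real \<nu>) ^ \<nu>"
      have Q: "?Q > 0"
        using \<nu> K by simp
      have "(L / 2) ^ \<nu> * (v L - v R + 4 * sqrt (R / L) * (v R - v 0)) \<le> (L / 2) ^ \<nu> * (\<delta> * v L)"
        using B L by (intro mult_left_mono) auto
      also have "\<dots> \<le> (D * real n powr \<alpha> / 2) ^ \<nu> * (\<delta> * v L)"
        using LD L \<open>\<delta> > 0\<close> v_nonneg by (intro mult_right_mono power_mono) auto
      also have "\<dots> = (D * real n powr \<alpha> / 2 * (2 * C_lam / D)) ^ \<nu> * v L"
        unfolding \<delta>_def by (subst power_mult_distrib) (simp only: mult.assoc)
      also have "D * real n powr \<alpha> / 2 * (2 * C_lam / D) = C_lam * real n powr \<alpha>"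
        using D by simp
      also have "(C_lam * real n powr \<alpha>) ^ \<nu> = C_lam ^ \<nu> * real n powr (\<alpha> * real \<nu>)"
        using n by (simp add: power_mult_distrib powr_powr flip: powr_realpow)
      finally have "2 / pi * ((L / 2) ^ \<nu> * (v L - v R + 4 * sqrt (R / L) * (v R - v 0))) / ?Q
          \<le> 2 / pi * (C_lam ^ \<nu> * real n powr (\<alpha> * real \<nu>) * v L) / ?Q"
        using Q by (intro divide_right_mono mult_left_mono) auto
      then have "chebyshev_rmse P vol n K (W n) \<gamma> (lam_n n) (e_n n)
          \<le> sqrt (real n) * (2 / pi * (C_lam ^ \<nu> * real n powr (\<alpha> * real \<nu>) * v L) / ?Q)"
        using cheb_approx_error_bv[OF L R \<nu> K diff v] n
        by (intro rmse) (auto simp: L_def mult.assoc intro: order_trans)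
      also have "\<dots> = 2 * C_lam ^ \<nu> * inverse (pi * real \<nu>) * v L
             * (real n powr (\<alpha> * real \<nu>) * sqrt (real n)) * inverse ((real K - real \<nu>) ^ \<nu>)"
        by (simp add: divide_inverse mult_ac)
      also have "real n powr (\<alpha> * real \<nu>) * sqrt (real n) = real n powr (\<alpha> * real \<nu> + 1 / 2)"
        by (simp add: powr_add powr_half_sqrt)
      finally show "chebyshev_rmse P vol n K (W n) \<gamma> (lam_n n) (e_n n)
          \<le> 2 * C_lam ^ \<nu> * inverse (pi * real \<nu>) * v (lam_n n n)
             * real n powr (\<alpha> * real \<nu> + 1 / 2) * inverse ((real K - real \<nu>) ^ \<nu>)"
        unfolding L_def .
    qed simp
  qed

  \<comment> \<open>The exponential rate for holomorphic densities\<close>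
  moreover have "\<exists>M_Cheb\<ge>1. \<forall>n>M_Cheb. \<forall>K\<ge>1.
           ereal (chebyshev_rmse P vol n K (W n) \<gamma> (lam_n n) (e_n n))
             \<le> ereal ((2 * C_lam / chi) powr (1 / 2))
                * (SUP z\<in>ellipse_region (lam_n n n) chi. ereal (cmod (\<Gamma> z)))
                * ereal (real n powr ((\<alpha> + 1) / 2)
                    * exp (- ((2 * C_lam / chi) powr (- 1 / 2)
                              * real n powr (- \<alpha> / 2) * real K)))"
    if chi: "chi > 0" and ext: "\<forall>x\<ge>0. \<Gamma> (complex_of_real x) = complex_of_real (\<gamma> x)"
      and hol: "\<forall>n\<ge>1. \<Gamma> holomorphic_on ellipse_region (lam_n n n) chi"
      and large: "large_weyl_constant lam \<alpha> C_lam C1 r q" for chi and \<Gamma> :: "complex \<Rightarrow> complex"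
  proof -
    \<comment> \<open>Either the discretization error is of lower order than
      \<open>n powr \<alpha>\<close>, so that it eventually fits into the second
      \<open>C_lam\<close>, or the required inequality for an auxiliary Weyl constant provides the
      factor 2 directly.\<close>
    have "\<forall>\<^sub>F n in sequentially. lam_n n n \<le> 2 * C_lam * real n powr \<alpha>"
      using large unfolding large_weyl_constant_def
    proof (elim disjE exE conjE)
      assume "\<alpha> * q < r + \<alpha>"
      then have "\<forall>\<^sub>F n in sequentially. C1 * C_lam powr q \<le> C_lam * real n powr (r + \<alpha> - \<alpha> * q)"
        using C by (intro eventually_const_le_powr) auto
      then show ?thesis
        using eventually_gt_at_top[of "M0 + N0"]
      proof eventually_elim
        case (elim n)
        have "C1 * C_lam powr q * real n powr (\<alpha> * q - r - \<alpha>)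
            \<le> C_lam * real n powr (r + \<alpha> - \<alpha> * q) * real n powr (\<alpha> * q - r - \<alpha>)"
          using elim by (intro mult_right_mono) auto
        also have "\<dots> = C_lam"
          using elim by (simp add: mult.assoc powr_add[symmetric])
        finally have "(C_lam + C1 * C_lam powr q * real n powr (\<alpha> * q - r - \<alpha>)) * real n powr \<alpha>
            \<le> 2 * C_lam * real n powr \<alpha>"
          by (intro mult_right_mono) auto
        then show ?case
          using lam_max(1)[OF elim(2) C(1)] weyl' by fastforce
      qed
    next
      fix C' assume C': "0 < C'" "C' + C1 * C' powr q \<le> 2 * C_lam"
        and up: "\<forall>j\<ge>1. 0 < lam j \<longrightarrow> lam j \<le> C' * real j powr \<alpha>"
      show ?thesis
        using eventually_gt_at_top[of "M0 + N0"]
      proof eventually_elim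
        case (elim n)
        have "lam_n n n \<le> (C' + C1 * C' powr q * real n powr (\<alpha> * q - r - \<alpha>)) * real n powr \<alpha>"
          using up by (intro lam_max(1)[OF elim C'(1)]) auto
        also have "\<dots> \<le> (C' + C1 * C' powr q * 1) * real n powr \<alpha>"
          using elim d powr_mono[of "\<alpha> * q - r - \<alpha>" 0 "real n"]
          by (intro mult_right_mono add_left_mono mult_left_mono) auto
        also have "\<dots> \<le> 2 * C_lam * real n powr \<alpha>"
          using C' by (intro mult_right_mono) auto
        finally show ?case .
      qed
    qed
    moreover have "\<forall>\<^sub>F n in sequentially. 1 \<le> 2 * C_lam / chi * real n powr \<alpha>"
      using C chi \<alpha> by (intro eventually_const_le_powr) auto
    ultimately obtain N where N: "\<And>n. n \<ge> N \<Longrightarrow> lam_n n n \<le> 2 * C_lam * real n powr \<alpha>"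
        "\<And>n. n \<ge> N \<Longrightarrow> 1 \<le> 2 * C_lam / chi * real n powr \<alpha>"
      unfolding eventually_sequentially by (metis nat_le_linear order_trans)
    show ?thesis
    proof (intro exI[of _ "M0 + N0 + N + 1"] conjI allI impI)
      fix n K assume n: "M0 + N0 + N + 1 < n" and "1 \<le> (K :: nat)"
      define L where "L = lam_n n n"
      have "0 < l * c_lam * real n powr \<alpha>"
        using C d n by simp
      then have L: "L > 0"
        unfolding L_def using low[of n] n by linarith
      \<comment> \<open>\<open>X\<close> is the reciprocal of half the radius increment: with
        \<open>s = 2 / X\<close> the prefactor \<open>2 / s\<close> is \<open>X\<close>, the decay
        rate \<open>s / 2\<close> is \<open>1 / X\<close>, and \<open>s \<le> 2\<close> amounts to
        \<open>1 \<le> X\<close>.\<close>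
      define X where "X = (2 * C_lam / chi) powr (1 / 2) * real n powr (\<alpha> / 2)"
      have X: "X > 0"
        unfolding X_def using C chi n by simp
      have X2: "X\<^sup>2 = 2 * C_lam / chi * real n powr \<alpha>"
        unfolding X_def power_mult_distrib using C chi n
        by (simp add: powr_powr flip: powr_realpow)
      have "1 \<le> X\<^sup>2"
        unfolding X2 using N(2)[of n] n by simp
      then have "1 \<le> X"
        using X by (simp add: power2_le_imp_le[of 1 X])
      have s: "0 < 2 / X" "2 / X \<le> 2" "(2 / X)\<^sup>2 \<le> 4 * chi / L"
      proof -
        have "(2 / X)\<^sup>2 = 4 * chi / (2 * C_lam * real n powr \<alpha>)"
          unfolding power_divide X2 using chi by simp
        also have "\<dots> \<le> 4 * chi / L"
          using N(1)[of n] n L chi C by (intro divide_left_mono) (auto simp: L_def)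
        finally show "(2 / X)\<^sup>2 \<le> 4 * chi / L" .
      qed (use X \<open>1 \<le> X\<close> in \<open>auto simp: field_simps\<close>)
      have powers: "2 / (2 / X) = (2 * C_lam / chi) powr (1 / 2) * real n powr (\<alpha> / 2)"
          "2 / X / 2 = (2 * C_lam / chi) powr (- 1 / 2) * real n powr (- \<alpha> / 2)"
      proof -
        show "2 / (2 / X) = (2 * C_lam / chi) powr (1 / 2) * real n powr (\<alpha> / 2)"
          unfolding X_def[symmetric] using X by simp
        have "2 / X / 2 = inverse X"
          using X by (simp add: field_simps)
        also have "\<dots> = (2 * C_lam / chi) powr - (1 / 2) * real n powr - (\<alpha> / 2)"
          by (simp only: X_def inverse_mult_distrib powr_minus)
        finally show "2 / X / 2 = (2 * C_lam / chi) powr (- 1 / 2) * real n powr (- \<alpha> / 2)"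
          by (simp only: minus_divide_left)
      qed
      \<comment> \<open>The supremum is an extended real. If it is infinite, the right-hand side is
        infinite as well; the value at 0, a point of the ellipse, rules out minus infinity.\<close>
      let ?S = "SUP z\<in>ellipse_region L chi. ereal (cmod (\<Gamma> z))"
      have "0 \<in> ellipse_region L chi"
        unfolding ellipse_region_def using L chi by simp
      then have S0: "ereal (cmod (\<Gamma> 0)) \<le> ?S"
        by (rule SUP_upper)
      have "ereal (chebyshev_rmse P vol n K (W n) \<gamma> (lam_n n) (e_n n))
          \<le> ereal ((2 * C_lam / chi) powr (1 / 2)) * ?S
                * ereal (real n powr ((\<alpha> + 1) / 2)
                    * exp (- ((2 * C_lam / chi) powr (- 1 / 2)
                              * real n powr (- \<alpha> / 2) * real K)))"
      proof (cases ?S)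
        case (real M)
        have M: "cmod (\<Gamma> z) \<le> M" if "z \<in> ellipse_region L chi" for z
          using SUP_upper[OF that, of "\<lambda>z. ereal (cmod (\<Gamma> z))"] unfolding real by simp
        have "0 \<le> M"
          using S0 unfolding real by (simp add: order_trans[OF norm_ge_zero])
        have "\<Gamma> holomorphic_on ellipse_region L chi"
          using hol n unfolding L_def by auto
        then have "chebyshev_rmse P vol n K (W n) \<gamma> (lam_n n) (e_n n)
            \<le> sqrt (real n) * (2 / (2 / X) * M * exp (- (2 / X / 2 * real K)))"
          using n ext
          by (intro rmse cheb_approx_error_holomorphic[OF _ _ _ _ _ \<open>0 \<le> M\<close> s(1,2), of _ _ _ chi])
            (auto simp: L_def[symmetric] L M s(3) intro: continuous_on_subset[OF \<gamma>_cont])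
        also have "\<dots> = (2 * C_lam / chi) powr (1 / 2) * M * (real n powr ((\<alpha> + 1) / 2)
            * exp (- ((2 * C_lam / chi) powr (- 1 / 2) * real n powr (- \<alpha> / 2) * real K)))"
          unfolding powers add_divide_distrib powr_add by (simp add: powr_half_sqrt mult_ac)
        finally show ?thesis
          unfolding real by simp
      next
        case PInf
        then show ?thesis
          using C chi n by simp
      next
        case MInf
        then show ?thesis
          using S0 by simp
      qed
      then show "ereal (chebyshev_rmse P vol n K (W n) \<gamma> (lam_n n) (e_n n))
          \<le> ereal ((2 * C_lam / chi) powr (1 / 2))
                * (SUP z\<in>ellipse_region (lam_n n n) chi. ereal (cmod (\<Gamma> z)))
                * ereal (real n powr ((\<alpha> + 1) / 2)
                    * exp (- ((2 * C_lam / chi) powr (- 1 / 2)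
                              * real n powr (- \<alpha> / 2) * real K)))"
        unfolding L_def .
    qed simp
  qed
  ultimately show ?thesis
    unfolding v_def by blast
qed

end
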